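(* Let $k$ and $n\geq 4k-1$ be two positive integers such that $k\cdot n$ is even, and let $\mathcal{G}=\{G_1,\ldots,G_{\frac{kn}{2}}\}$ be a collection of (not necessarily distinct) simple graphs on the same vertex set $V=\{1,\dots,n\}$. If $\rho(G_i)\geq\rho(H_{n,k})$ for $i=1,2,\ldots,\frac{kn}{2}$, then $\mathcal{G}$ admits a rainbow $k$-factor unless $G_1=G_2=\cdots=G_{\frac{kn}{2}}\cong H_{n,k}$.
   Context: $\rho(G)$ denotes the spectral radius (largest eigenvalue of the adjacency matrix) of a graph $G$. $\vee$ denotes the join and $\cup$ the disjoint union of graphs, and $H_{n,k}=K_{k-1}\vee(K_1\cup K_{n-k})$. Two graphs are identical ($G=G'$) if they have the same vertex set and the same edge set; $\cong$ denotes isomorphism. A $k$-factor is a $k$-regular spanning subgraph. For a collection $\mathcal{G}=\{G_1,\dots,G_m\}$ of graphs on a common vertex set $V$ and a graph $H$ with $m$ edges and $V(H)\subseteq V$, $\mathcal{G}$ admits a rainbow $H$ if there is a bijection $\varphi:E(H)\to\{1,\dots,m\}$ with $e\in E(G_{\varphi(e)})$ for every $e\in E(H)$. $\mathcal{G}$ admits a rainbow $k$-factor if there is a $k$-regular graph $F$ on vertex set $V$ such that $\mathcal{G}$ admits a rainbow $F$. *)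

theory Defs
  imports "Jordan_Normal_Form.Spectral_Radius"
begin

text \<open>An undirected graph is a vertex set together with a set of edges, an edge being the set of
  its two endpoints. Equality in this type is identity of graphs.\<close>

datatype 'a ugraph = UGraph (verts: "'a set") (edges: "'a set set")

definition simple_graph :: "'a ugraph \<Rightarrow> bool" where
  "simple_graph G \<longleftrightarrow> finite (verts G) \<and> (\<forall>e \<in> edges G. e \<subseteq> verts G \<and> card e = 2)"

definition graph_iso :: "'a ugraph \<Rightarrow> 'b ugraph \<Rightarrow> bool" (infix "\<cong>\<^sub>G" 50) where
  "G \<cong>\<^sub>G H \<longleftrightarrow> (\<exists>f. bij_betw f (verts G) (verts H) \<and>
     (\<forall>u \<in> verts G. \<forall>v \<in> verts G. {u, v} \<in> edges G \<longleftrightarrow> {f u, f v} \<in> edges H))"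

definition complete_graph :: "nat \<Rightarrow> nat ugraph" where
  "complete_graph n = UGraph {1..n} {e. e \<subseteq> {1..n} \<and> card e = 2}"

definition graph_union :: "'a ugraph \<Rightarrow> 'b ugraph \<Rightarrow> ('a + 'b) ugraph" where
  "graph_union G H = UGraph (verts G <+> verts H) ((`) Inl ` edges G \<union> (`) Inr ` edges H)"

definition graph_join :: "'a ugraph \<Rightarrow> 'b ugraph \<Rightarrow> ('a + 'b) ugraph" where
  "graph_join G H = UGraph (verts G <+> verts H)
     ((`) Inl ` edges G \<union> (`) Inr ` edges H \<union> {{Inl u, Inr v} | u v. u \<in> verts G \<and> v \<in> verts H})"

definition H_graph :: "nat \<Rightarrow> nat \<Rightarrow> (nat + nat + nat) ugraph" where
  "H_graph n k =
     graph_join (complete_graph (k - 1)) (graph_union (complete_graph 1) (complete_graph (n - k)))"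

definition adjacency_matrix :: "(nat \<Rightarrow> 'a) \<Rightarrow> 'a ugraph \<Rightarrow> real mat" where
  "adjacency_matrix f G = mat (card (verts G)) (card (verts G))
     (\<lambda>(i, j). if {f i, f j} \<in> edges G then 1 else 0)"

text \<open>The rows and columns are indexed along an arbitrary enumeration of the vertices, on which the
  spectrum does not depend (lemma \<open>spectrum_adjacency_matrix_unique\<close> below). The adjacency matrix
  is real symmetric, so its largest eigenvalue is the maximum of its spectrum over the reals.\<close>

definition graph_spectral_radius :: "'a ugraph \<Rightarrow> real" ("\<rho>") where
  "\<rho> G = Max (spectrum (adjacency_matrix (SOME f. bij_betw f {..<card (verts G)} (verts G)) G))"

lemma spectrum_adjacency_matrix_iff:
  assumes f: "bij_betw f {..<card (verts G)} (verts G)"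
  shows "l \<in> spectrum (adjacency_matrix f G) \<longleftrightarrow>
    (\<exists>x. (\<exists>v\<in>verts G. x v \<noteq> 0) \<and>
      (\<forall>v\<in>verts G. (\<Sum>u\<in>verts G. (if {v, u} \<in> edges G then 1 else 0) * x u) = l * x v))"
    (is "_ \<longleftrightarrow> ?R")
proof -
  let ?n = "card (verts G)"
  let ?A = "adjacency_matrix f G"
  have A: "?A \<in> carrier_mat ?n ?n"
    by (simp add: adjacency_matrix_def)
  have img: "f ` {..<?n} = verts G"
    using f by (simp add: bij_betw_def)
  have mult: "(?A *\<^sub>v w) $ i = (\<Sum>j<?n. (if {f i, f j} \<in> edges G then 1 else 0) * w $ j)"
    if "i < ?n" "w \<in> carrier_vec ?n" for i and w :: "real vec"
    using that by (auto simp: adjacency_matrix_def scalar_prod_def lessThan_atLeast0 intro!: sum.cong)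
  have reindex: "(\<Sum>u\<in>verts G. g u) = (\<Sum>j<?n. g (f j))" for g :: "'a \<Rightarrow> real"
    using sum.reindex_bij_betw[OF f, of g] by simp
  show ?thesis
  proof
    assume "l \<in> spectrum ?A"
    then obtain w where w: "w \<in> carrier_vec ?n" "w \<noteq> 0\<^sub>v ?n" "?A *\<^sub>v w = l \<cdot>\<^sub>v w"
      using A by (auto simp: spectrum_def eigenvalue_def eigenvector_def)
    define x where "x v = w $ the_inv_into {..<?n} f v" for v
    have x: "x (f i) = w $ i" if "i < ?n" for i
      using that f by (simp add: x_def bij_betw_def the_inv_into_f_f)
    obtain i where "i < ?n" "w $ i \<noteq> 0"
    proof -
      have "\<exists>i<?n. w $ i \<noteq> 0"
      proof (rule ccontr)
        assume "\<not> (\<exists>i<?n. w $ i \<noteq> 0)"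
        then have "w = 0\<^sub>v ?n"
          using w(1) by (intro eq_vecI) auto
        then show False
          using w(2) by simp
      qed
      then show ?thesis
        using that by blast
    qed
    then have 1: "\<exists>v\<in>verts G. x v \<noteq> 0"
      using x img by force
    have 2: "(\<Sum>u\<in>verts G. (if {f i, u} \<in> edges G then 1 else 0) * x u) = l * x (f i)"
      if "i < ?n" for i
    proof -
      have "(\<Sum>u\<in>verts G. (if {f i, u} \<in> edges G then 1 else 0) * x u) = (?A *\<^sub>v w) $ i"
        unfolding reindex mult[OF that w(1)] by (intro sum.cong) (auto simp: x)
      then show ?thesis
        using w that by (simp add: x)
    qed
    have "(\<Sum>u\<in>verts G. (if {v, u} \<in> edges G then 1 else 0) * x u) = l * x v"
      if "v \<in> verts G" for v
    proof -
      have "v \<in> f ` {..<?n}"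
        using that by (simp only: img)
      then obtain i where "i < ?n" "v = f i"
        by blast
      then show ?thesis
        using 2 by simp
    qed
    then show ?R
      using 1 by blast
  next
    assume ?R
    then obtain x where x: "\<exists>v\<in>verts G. x v \<noteq> 0"
      "\<And>v. v \<in> verts G \<Longrightarrow> (\<Sum>u\<in>verts G. (if {v, u} \<in> edges G then 1 else 0) * x u) = l * x v"
      by blast
    define w where "w = vec ?n (\<lambda>i. x (f i))"
    have wc: "w \<in> carrier_vec ?n"
      by (simp add: w_def)
    have "\<exists>v\<in>f ` {..<?n}. x v \<noteq> 0"
      using x(1) by (simp only: img)
    then obtain i where "i < ?n" "x (f i) \<noteq> 0"
      by blast
    then have "w $ i \<noteq> 0\<^sub>v ?n $ i"
      by (simp add: w_def)
    then have "w \<noteq> 0\<^sub>v ?n"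
      by auto
    moreover have "?A *\<^sub>v w = l \<cdot>\<^sub>v w"
    proof (rule eq_vecI)
      fix i assume "i < dim_vec (l \<cdot>\<^sub>v w)"
      then have i: "i < ?n"
        by (simp add: w_def)
      have "(?A *\<^sub>v w) $ i = (\<Sum>u\<in>verts G. (if {f i, u} \<in> edges G then 1 else 0) * x u)"
        unfolding reindex mult[OF i wc] by (intro sum.cong) (auto simp: w_def)
      also have "\<dots> = l * x (f i)"
        using bij_betwE[OF f] i by (intro x(2)) simp
      finally show "(?A *\<^sub>v w) $ i = (l \<cdot>\<^sub>v w) $ i"
        using i by (simp add: w_def)
    qed (use A wc in auto)
    ultimately show "l \<in> spectrum ?A"
      using A wc by (auto simp: spectrum_def eigenvalue_def eigenvector_def)
  qed
qed

lemma spectrum_adjacency_matrix_unique: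
  assumes "bij_betw f {..<card (verts G)} (verts G)" "bij_betw g {..<card (verts G)} (verts G)"
  shows "spectrum (adjacency_matrix f G) = spectrum (adjacency_matrix g G)"
  using assms by (auto simp: spectrum_adjacency_matrix_iff)

definition vertex_degree :: "'a ugraph \<Rightarrow> 'a \<Rightarrow> nat" where
  "vertex_degree G v = card {e \<in> edges G. v \<in> e}"

definition regular_graph :: "nat \<Rightarrow> 'a ugraph \<Rightarrow> bool" where
  "regular_graph k G \<longleftrightarrow> simple_graph G \<and> (\<forall>v \<in> verts G. vertex_degree G v = k)"

text \<open>A collection of \<open>m\<close> graphs is a function on indices, of which only the values at
  \<open>1, \<dots>, m\<close> matter.\<close>

definition admits_rainbow :: "nat \<Rightarrow> (nat \<Rightarrow> 'a ugraph) \<Rightarrow> 'a ugraph \<Rightarrow> bool" where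
  "admits_rainbow m \<G> H \<longleftrightarrow>
     (\<exists>\<phi>. bij_betw \<phi> (edges H) {1..m} \<and> (\<forall>e \<in> edges H. e \<in> edges (\<G> (\<phi> e))))"

definition admits_rainbow_factor :: "nat \<Rightarrow> 'a set \<Rightarrow> nat \<Rightarrow> (nat \<Rightarrow> 'a ugraph) \<Rightarrow> bool" where
  "admits_rainbow_factor k V m \<G> \<longleftrightarrow>
     (\<exists>F. verts F = V \<and> regular_graph k F \<and> admits_rainbow m \<G> F)"

end

theory Submission
  imports Defs "HOL-Combinatorics.Transposition" "HOL-Analysis.Function_Topology" "HOL-Analysis.Convex"
begin

text \<open>Shifting all graphs towards small labels, that is, replacing edges \<open>{y, z}\<close> by \<open>{x, z}\<close> for some
  \<open>x < y\<close>, does not decrease the spectral radius, and a rainbow \<open>k\<close>-factor of the shifted family can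
  be pulled back to the original family. Hence the family may be assumed to be shifted, unless a shift
  turns all graphs into one copy of \<open>H\<^sub>n\<^sub>,\<^sub>k\<close>; but then the graphs before that shift are so close to
  \<open>H\<^sub>n\<^sub>,\<^sub>k\<close> that a rainbow factor can be written down.

  A shifted graph of spectral radius at least \<open>\<rho>(H\<^sub>n\<^sub>,\<^sub>k)\<close> that does not contain \<open>{k, n}\<close> is a subgraph of
  \<open>H\<^sub>n\<^sub>,\<^sub>k\<close>, hence equal to it. If it contains \<open>{k, n}\<close>, Hong's bound \<open>\<rho>\<^sup>2 \<le> 2m - n + 1\<close> shows
  that it misses at most \<open>n - 2\<close> edges, and by shiftedness only edges between large labels. So there is
  one \<open>k\<close>-regular graph whose edges other than \<open>{k, n}\<close> lie in all graphs of the family, and \<open>{k, n}\<close>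
  can be taken from a graph different from \<open>H\<^sub>n\<^sub>,\<^sub>k\<close>.\<close>

section \<open>Shifting and rainbow factors\<close>

text \<open>One pair \<open>x\<close>, \<open>y\<close> has to be shifted in all graphs at once: the
  pull-back swaps \<open>x\<close> and \<open>y\<close> in edges of the factor, and their colours
  are spread over the whole family. The obstacle is the excluded family. A shift may create it from
  a family that is not excluded, and then induction on shifts gives nothing. So the induction
  excludes every labelled copy of H_{n,k}, not only the shifted one, and the single shift that ends
  in such a copy is undone by hand. Spectral radii enter the combinatorics only through a
  nonnegative vector with large Rayleigh quotient. The numerical input is the bound
  \<open>n - 2\<close> for the spectral radius of H_{n,k}, which contains a clique on
  \<open>n - 1\<close> vertices; the exact value matters only for subgraphs of H_{n,k}. The factors
  written down at the end all come from one graph, in which two vertices share \<open>k - 1\<close>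
  neighbours and have one private neighbour each, placed so that at most two of its edges depend on
  the member of the family.\<close>

definition pairs :: "'a set \<Rightarrow> 'a set set" where
  "pairs V = {e. e \<subseteq> V \<and> card e = 2}"

definition shift_edge :: "'a \<Rightarrow> 'a \<Rightarrow> 'a set \<Rightarrow> 'a set" where
  "shift_edge x y e = (if y \<in> e \<and> x \<notin> e then insert x (e - {y}) else e)"

definition shift :: "'a \<Rightarrow> 'a \<Rightarrow> 'a set set \<Rightarrow> 'a set set" where
  "shift x y E = {e \<in> E. shift_edge x y e \<in> E} \<union> shift_edge x y ` E"

text \<open>The shift carried out edge by edge. An edge whose replacement is already present stays,
  so the map is injective on \<open>E\<close>; edge counts and sums over \<open>shift x y E\<close>
  are reindexed along it.\<close>

definition shift_in :: "'a \<Rightarrow> 'a \<Rightarrow> 'a set set \<Rightarrow> 'a set \<Rightarrow> 'a set" where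
  "shift_in x y E e = (if shift_edge x y e \<in> E then e else shift_edge x y e)"

definition regular_edges :: "nat \<Rightarrow> 'a set \<Rightarrow> 'a set set \<Rightarrow> bool" where
  "regular_edges k V F \<longleftrightarrow> F \<subseteq> pairs V \<and> (\<forall>v\<in>V. card {e \<in> F. v \<in> e} = k)"

definition rainbow :: "nat \<Rightarrow> 'a set \<Rightarrow> 'i set \<Rightarrow> ('i \<Rightarrow> 'a set set) \<Rightarrow> bool" where
  "rainbow k V I E \<longleftrightarrow>
     (\<exists>F \<phi>. regular_edges k V F \<and> bij_betw \<phi> F I \<and> (\<forall>e\<in>F. e \<in> E (\<phi> e)))"

lemma finite_pairs: "finite V \<Longrightarrow> finite (pairs V)"
  unfolding pairs_def by (rule finite_subset[of _ "Pow V"]) auto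

lemma pair_in_pairs [simp]: "{u, v} \<in> pairs V \<longleftrightarrow> u \<in> V \<and> v \<in> V \<and> u \<noteq> v"
  by (auto simp: pairs_def card_2_iff doubleton_eq_iff)

lemma pairsE:
  assumes "e \<in> pairs V" "v \<in> e"
  obtains u where "e = {v, u}" "u \<in> V" "v \<in> V" "u \<noteq> v"
proof -
  from assms obtain a b where "e = {a, b}" "a \<noteq> b"
    by (auto simp: pairs_def card_2_iff)
  then show ?thesis
    using assms that[of a] that[of b] by (auto simp: insert_commute)
qed

lemma shift_edge_pairs:
  assumes "e \<in> pairs V" "x \<in> V"
  shows "shift_edge x y e \<in> pairs V"
proof (cases "y \<in> e \<and> x \<notin> e")
  case True
  then obtain u where "e = {y, u}" "u \<in> V" "u \<noteq> y"
    using assms(1) by (auto elim: pairsE)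
  with True assms(2) have "shift_edge x y e = {x, u}" "u \<noteq> x"
    by (auto simp: shift_edge_def)
  then show ?thesis
    using \<open>u \<in> V\<close> assms(2) by simp
qed (use assms in \<open>auto simp: shift_edge_def\<close>)

lemma shift_pairs: "E \<subseteq> pairs V \<Longrightarrow> x \<in> V \<Longrightarrow> shift x y E \<subseteq> pairs V"
  by (auto simp: shift_def intro: shift_edge_pairs)

lemma shift_edge_pair [simp]: "z \<noteq> x \<Longrightarrow> z \<noteq> y \<Longrightarrow> x \<noteq> y \<Longrightarrow> shift_edge x y {y, z} = {x, z}"
  "shift_edge x y {x, z} = {x, z}"
  "y \<notin> e \<Longrightarrow> shift_edge x y e = e"
  by (auto simp: shift_edge_def)

lemma shift_edge_idem: "x \<noteq> y \<Longrightarrow> shift_edge x y (shift_edge x y e) = shift_edge x y e"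
  by (auto simp: shift_edge_def)

lemma shift_eq_image: "x \<noteq> y \<Longrightarrow> shift x y E = shift_in x y E ` E"
  by (auto simp: shift_def shift_in_def image_iff shift_edge_idem split: if_splits)

text \<open>An edge that really moves lands outside \<open>E\<close>, so it cannot meet one that
  stays; two moved edges with the same image coincide, because putting \<open>y\<close> back for
  \<open>x\<close> recovers each of them.\<close>

lemma inj_on_shift_in:
  assumes "x \<noteq> y"
  shows "inj_on (shift_in x y E) E"
proof -
  have "e = insert y (shift_edge x y e - {x})" if "shift_edge x y e \<noteq> e" for e
    using that assms by (auto simp: shift_edge_def split: if_splits)
  then have *: "e = e'" if "shift_edge x y e = shift_edge x y e'" "shift_edge x y e \<noteq> e" "shift_edge x y e' \<noteq> e'" for e e'
    using that by metis
  show ?thesis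
  proof (rule inj_onI)
    fix e e' assume e: "e \<in> E" "e' \<in> E" "shift_in x y E e = shift_in x y E e'"
    have "shift_in x y E d = (if shift_edge x y d \<in> E then d else shift_edge x y d)" for d
      by (rule shift_in_def)
    then show "e = e'"
      using e * by metis
  qed
qed

lemma card_shift: "x \<noteq> y \<Longrightarrow> card (shift x y E) = card E"
  by (simp add: shift_eq_image card_image inj_on_shift_in)

lemma shift_off:
  assumes "x \<noteq> y" "x \<notin> e" "y \<notin> e"
  shows "e \<in> shift x y E \<longleftrightarrow> e \<in> E"
  using assms by (auto simp: shift_def shift_edge_def split: if_splits)

lemma shift_both:
  assumes "x \<noteq> y"
  shows "{x, y} \<in> shift x y E \<longleftrightarrow> {x, y} \<in> E"
  using assms by (auto simp: shift_def shift_edge_def split: if_splits)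

text \<open>Outside \<open>{x, y}\<close> the shift hands \<open>x\<close> the union and, by
  \<open>shift_source\<close>, leaves \<open>y\<close> the intersection of the two old
  neighbourhoods.\<close>

lemma shift_target:
  assumes "x \<noteq> y" "z \<noteq> x" "z \<noteq> y"
  shows "{x, z} \<in> shift x y E \<longleftrightarrow> {x, z} \<in> E \<or> {y, z} \<in> E"
proof
  assume "{x, z} \<in> shift x y E"
  then consider "{x, z} \<in> E" | e where "e \<in> E" "{x, z} = shift_edge x y e"
    by (auto simp: shift_def)
  then show "{x, z} \<in> E \<or> {y, z} \<in> E"
  proof cases
    case (2 e)
    then show ?thesis
    proof (cases "y \<in> e \<and> x \<notin> e")
      case True
      with 2 have eq: "{x, z} = insert x (e - {y})"
        by (simp add: shift_edge_def)
      have "e - {y} = {x, z} - {x}"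
        using eq True by (metis Diff_insert_absorb Diff_iff)
      then have "e = {y, z}"
        using True assms(2) by (auto simp: insert_Diff_if)
      then show ?thesis using 2 by simp
    qed (auto simp: shift_edge_def)
  qed simp
next
  have "shift_edge x y {y, z} = {x, z}" "shift_edge x y {x, z} = {x, z}"
    using assms by simp_all
  then show "{x, z} \<in> E \<or> {y, z} \<in> E \<Longrightarrow> {x, z} \<in> shift x y E"
    by (auto simp: shift_def intro: rev_image_eqI)
qed

lemma shift_source:
  assumes "x \<noteq> y" "z \<noteq> x" "z \<noteq> y"
  shows "{y, z} \<in> shift x y E \<longleftrightarrow> {x, z} \<in> E \<and> {y, z} \<in> E"
proof -
  have "{y, z} \<noteq> shift_edge x y e" for e
    using assms by (auto simp: shift_edge_def)
  then show ?thesis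
    using assms by (auto simp: shift_def)
qed

lemma regular_edges_card:
  assumes "finite V" "regular_edges k V F"
  shows "2 * card F = k * card V"
proof -
  have F: "F \<subseteq> pairs V" "finite F"
    using assms finite_pairs finite_subset by (auto simp: regular_edges_def)
  have "k * card V = (\<Sum>v\<in>V. card {e\<in>F. v \<in> e})"
    using assms by (simp add: regular_edges_def)
  also have "\<dots> = (\<Sum>e\<in>F. card {v\<in>V. v \<in> e})"
    by (intro sum_multicount_gen assms(1) F(2)) simp
  also have "\<dots> = (\<Sum>e\<in>F. 2)"
  proof (rule sum.cong)
    fix e assume "e \<in> F"
    with F have "{v\<in>V. v \<in> e} = e" "card e = 2"
      by (auto simp: pairs_def)
    then show "card {v\<in>V. v \<in> e} = 2" by simp
  qed simp
  finally show ?thesis by simp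
qed

text \<open>Swapping \<open>x\<close> and \<open>y\<close> on the edges that join them to a set \<open>T\<close> of other vertices turns
  a factor of the shifted family into one of the original family. The set \<open>T\<close> has to contain every
  \<open>z\<close> whose edge to \<open>x\<close> was created by the shift, and is completed to keep all degrees.\<close>

lemma rainbow_shift:
  assumes V: "finite V" and xy: "x \<in> V" "y \<in> V" "x \<noteq> y"
    and rb: "rainbow k V I (\<lambda>i. shift x y (E i))"
  shows "rainbow k V I E"
proof -
  obtain F \<phi> where F: "regular_edges k V F" "bij_betw \<phi> F I" "\<And>e. e \<in> F \<Longrightarrow> e \<in> shift x y (E (\<phi> e))"
    using rb by (auto simp: rainbow_def)
  have Fp: "F \<subseteq> pairs V" and finF: "finite F" and deg: "\<And>v. v \<in> V \<Longrightarrow> card {e \<in> F. v \<in> e} = k"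
    using F(1) V finite_pairs finite_subset by (auto simp: regular_edges_def)
  define X where "X = {z \<in> V - {x, y}. {x, z} \<in> F}"
  define Y where "Y = {z \<in> V - {x, y}. {y, z} \<in> F}"
  define Z where "Z = {z \<in> X. {x, z} \<notin> E (\<phi> {x, z})}"
  have fin: "finite X" "finite Y" "Z \<subseteq> X"
    using V by (auto simp: X_def Y_def Z_def)
  have inj: "inj_on (\<lambda>z. {v, z}) A" for v :: 'a and A
    by (auto simp: inj_on_def doubleton_eq_iff)
  have starx: "{e \<in> F. x \<in> e} = {e \<in> F. e = {x, y}} \<union> (\<lambda>z. {x, z}) ` X"
    using Fp xy by (auto simp: X_def elim!: pairsE)
  have stary: "{e \<in> F. y \<in> e} = {e \<in> F. e = {x, y}} \<union> (\<lambda>z. {y, z}) ` Y"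
  proof -
    have "{e \<in> F. y \<in> e} = {e \<in> F. e = {y, x}} \<union> (\<lambda>z. {y, z}) ` Y"
      using Fp xy by (auto simp: Y_def elim!: pairsE)
    then show ?thesis
      by (simp only: insert_commute)
  qed
  have "card {e \<in> F. x \<in> e} = card {e \<in> F. e = {x, y}} + card X"
    unfolding starx using finF fin inj by (subst card_Un_disjoint) (auto simp: card_image X_def doubleton_eq_iff)
  moreover have "card {e \<in> F. y \<in> e} = card {e \<in> F. e = {x, y}} + card Y"
    unfolding stary using finF fin inj by (subst card_Un_disjoint) (auto simp: card_image Y_def doubleton_eq_iff)
  ultimately have XY: "card X = card Y"
    using deg[OF xy(1)] deg[OF xy(2)] by simp
  \<comment> \<open>Equal degrees of \<open>x\<close> and \<open>y\<close> give
    \<open>card X = card Y\<close>, so \<open>Y - X\<close> has room for a set \<open>U\<close> as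
    large as \<open>Z - Y\<close>. Swapping at \<open>Z\<close> and \<open>U\<close> then moves
    equally many edges each way.\<close>
  have "card (Z - Y) \<le> card (X - Y)"
    using fin by (intro card_mono) auto
  also have "\<dots> = card (Y - X)"
    using XY fin by (simp add: card_Diff_subset_Int Int_commute)
  finally obtain U where U: "U \<subseteq> Y - X" "card U = card (Z - Y)"
    by (metis obtain_subset_with_card_n)
  define T where "T = Z \<union> U"
  have XT: "X \<inter> T = Z" and YT: "Y \<inter> T = (Z \<inter> Y) \<union> U"
    using U fin by (auto simp: T_def)
  have finZ: "finite Z" "finite U" "finite T"
    using fin U finite_subset by (auto simp: T_def intro: finite_subset)
  have "card (Y \<inter> T) = card (Z \<inter> Y) + card (Z - Y)"
    unfolding YT using finZ U fin by (subst card_Un_disjoint) auto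
  also have "\<dots> = card Z"
    using finZ by (metis card_Int_Diff Int_Diff)
  finally have bal: "card (Y \<inter> T) = card (X \<inter> T)"
    by (simp add: XT)
  have Txy: "x \<notin> T" "y \<notin> T"
    using fin U by (auto simp: T_def X_def Y_def)
  \<comment> \<open>The swap as a map on all sets. It is an involution, hence injective, and
    \<open>\<phi> \<circ> g\<close> gives every swapped edge the colour of its original.\<close>
  define g where "g e = (if \<exists>z\<in>T. e = {x, z} then {y, THE z. e = {x, z}}
      else if \<exists>z\<in>T. e = {y, z} then {x, THE z. e = {y, z}} else e)" for e
  have gx: "g {x, z} = {y, z}" if "z \<in> T" for z
  proof -
    have "(THE z'. {x, z} = {x, z'}) = z"
      by (auto simp: doubleton_eq_iff)
    then show ?thesis using that unfolding g_def by auto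
  qed
  have gy: "g {y, z} = {x, z}" if "z \<in> T" for z
  proof -
    have "(THE z'. {y, z} = {y, z'}) = z"
      by (auto simp: doubleton_eq_iff)
    moreover have "\<not> (\<exists>z'\<in>T. {y, z} = {x, z'})"
      using Txy that xy by (auto simp: doubleton_eq_iff)
    ultimately show ?thesis using that unfolding g_def by auto
  qed
  have gid: "g e = e" if "\<And>z. z \<in> T \<Longrightarrow> e \<noteq> {x, z}" "\<And>z. z \<in> T \<Longrightarrow> e \<noteq> {y, z}" for e
    using that unfolding g_def by auto
  have gcases: thesis if "\<And>z. z \<in> T \<Longrightarrow> e = {x, z} \<Longrightarrow> thesis" "\<And>z. z \<in> T \<Longrightarrow> e = {y, z} \<Longrightarrow> thesis"
    "g e = e \<Longrightarrow> (\<And>z. z \<in> T \<Longrightarrow> e \<noteq> {x, z}) \<Longrightarrow> (\<And>z. z \<in> T \<Longrightarrow> e \<noteq> {y, z}) \<Longrightarrow> thesis" for e thesis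
  proof (cases "(\<exists>z\<in>T. e = {x, z}) \<or> (\<exists>z\<in>T. e = {y, z})")
    case True
    then show ?thesis
      using that(1,2) by blast
  next
    case False
    then show ?thesis
      by (intro that(3) gid) auto
  qed
  have gg: "g (g e) = e" for e
    by (rule gcases[of e]) (simp_all add: gx gy)
  then have injg: "inj g"
    by (metis injI)
  have TV: "T \<subseteq> V - {x, y}"
    using fin U by (auto simp: T_def X_def Y_def)
  have gp: "g e \<in> pairs V" if "e \<in> pairs V" for e
    by (rule gcases[of e]) (use that TV xy in \<open>auto simp: gx gy\<close>)
  have gv: "v \<in> g e \<longleftrightarrow> v \<in> e" if "v \<noteq> x" "v \<noteq> y" for v e
    by (rule gcases[of e]) (use that in \<open>auto simp: gx gy\<close>)
  have cardg: "card {e \<in> g ` F. v \<in> e} = card {e \<in> F. v \<in> g e}" for v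
  proof -
    have "{e \<in> g ` F. v \<in> e} = g ` {e \<in> F. v \<in> g e}"
      by auto
    moreover have "inj_on g {e \<in> F. v \<in> g e}"
      using injg by (rule inj_on_subset) simp
    ultimately show ?thesis
      by (simp add: card_image)
  qed
  have gstarx: "{e \<in> F. x \<in> g e} = {e \<in> F. e = {x, y}} \<union> ((\<lambda>z. {x, z}) ` (X - T) \<union> (\<lambda>z. {y, z}) ` (Y \<inter> T))"
  proof (intro Set.set_eqI iffI)
    fix e assume e: "e \<in> {e \<in> F. x \<in> g e}"
    show "e \<in> {e \<in> F. e = {x, y}} \<union> ((\<lambda>z. {x, z}) ` (X - T) \<union> (\<lambda>z. {y, z}) ` (Y \<inter> T))"
    proof (rule gcases[of e])
      fix z assume "z \<in> T" "e = {x, z}"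
      then show ?thesis using e gx Txy xy by auto
    next
      fix z assume "z \<in> T" "e = {y, z}"
      then show ?thesis using e TV by (auto simp: Y_def)
    next
      assume *: "g e = e" "\<And>z. z \<in> T \<Longrightarrow> e \<noteq> {x, z}"
      then have "e \<in> {e \<in> F. x \<in> e}" using e by simp
      then show ?thesis unfolding starx using * by auto
    qed
  next
    fix e assume e: "e \<in> {e \<in> F. e = {x, y}} \<union> ((\<lambda>z. {x, z}) ` (X - T) \<union> (\<lambda>z. {y, z}) ` (Y \<inter> T))"
    moreover have "g {x, z} = {x, z}" if "z \<in> X - T" for z
      using that xy by (intro gid) (auto simp: X_def doubleton_eq_iff)
    moreover have "g {x, y} = {x, y}"
      using Txy xy by (intro gid) (auto simp: doubleton_eq_iff)
    ultimately show "e \<in> {e \<in> F. x \<in> g e}"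
      by (auto simp: X_def Y_def gy)
  qed
  have gstary: "{e \<in> F. y \<in> g e} = {e \<in> F. e = {x, y}} \<union> ((\<lambda>z. {y, z}) ` (Y - T) \<union> (\<lambda>z. {x, z}) ` (X \<inter> T))"
  proof (intro Set.set_eqI iffI)
    fix e assume e: "e \<in> {e \<in> F. y \<in> g e}"
    show "e \<in> {e \<in> F. e = {x, y}} \<union> ((\<lambda>z. {y, z}) ` (Y - T) \<union> (\<lambda>z. {x, z}) ` (X \<inter> T))"
    proof (rule gcases[of e])
      fix z assume "z \<in> T" "e = {y, z}"
      then show ?thesis using e gy Txy xy by auto
    next
      fix z assume "z \<in> T" "e = {x, z}"
      then show ?thesis using e TV by (auto simp: X_def)
    next
      assume *: "g e = e" "\<And>z. z \<in> T \<Longrightarrow> e \<noteq> {y, z}"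
      then have "e \<in> {e \<in> F. y \<in> e}" using e by simp
      then show ?thesis unfolding stary using * by auto
    qed
  next
    fix e assume e: "e \<in> {e \<in> F. e = {x, y}} \<union> ((\<lambda>z. {y, z}) ` (Y - T) \<union> (\<lambda>z. {x, z}) ` (X \<inter> T))"
    moreover have "g {y, z} = {y, z}" if "z \<in> Y - T" for z
      using that xy by (intro gid) (auto simp: Y_def doubleton_eq_iff)
    moreover have "g {x, y} = {x, y}"
      using Txy xy by (intro gid) (auto simp: doubleton_eq_iff)
    ultimately show "e \<in> {e \<in> F. y \<in> g e}"
      by (auto simp: X_def Y_def gx)
  qed
  have cardstar: "card ({e \<in> F. e = {x, y}} \<union> ((\<lambda>z. {a, z}) ` (A - T) \<union> (\<lambda>z. {b, z}) ` (B \<inter> T)))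
      = card {e \<in> F. e = {x, y}} + (card (A - T) + card (B \<inter> T))"
    if "finite A" "finite B" "x \<notin> A" "x \<notin> B" "y \<notin> A" "y \<notin> B" "{a, b} = {x, y}" for a b A B
  proof -
    have ab: "a \<noteq> b" "a \<notin> A" "b \<notin> A" "a \<notin> B" "b \<notin> B"
      using that xy by (auto simp: doubleton_eq_iff)
    have "card ((\<lambda>z. {a, z}) ` (A - T) \<union> (\<lambda>z. {b, z}) ` (B \<inter> T)) = card (A - T) + card (B \<inter> T)"
      using that(1,2) inj ab by (subst card_Un_disjoint) (auto simp: card_image doubleton_eq_iff)
    moreover have "{e \<in> F. e = {x, y}} \<inter> ((\<lambda>z. {a, z}) ` (A - T) \<union> (\<lambda>z. {b, z}) ` (B \<inter> T)) = {}"
      using ab that by (auto simp: doubleton_eq_iff)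
    ultimately show ?thesis
      using finF that(1,2) by (subst card_Un_disjoint) auto
  qed
  have cX: "card (X - T) + card (X \<inter> T) = card X" "card (Y - T) + card (Y \<inter> T) = card Y"
    using fin by (metis add.commute card_Int_Diff)+
  have notin: "x \<notin> X" "y \<notin> X" "x \<notin> Y" "y \<notin> Y"
    by (auto simp: X_def Y_def)
  have "card {e \<in> F. x \<in> g e} = k"
    using deg[OF xy(1)] \<open>card {e \<in> F. x \<in> e} = _\<close> cX bal notin fin
    unfolding gstarx by (subst cardstar) auto
  moreover have "card {e \<in> F. y \<in> g e} = k"
    using deg[OF xy(2)] \<open>card {e \<in> F. y \<in> e} = _\<close> cX bal notin fin
    unfolding gstary by (subst cardstar) auto
  moreover have "card {e \<in> F. v \<in> g e} = k" if "v \<in> V" "v \<noteq> x" "v \<noteq> y" for v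
    using deg[OF that(1)] gv[OF that(2,3)] by simp
  ultimately have "card {e \<in> g ` F. v \<in> e} = k" if "v \<in> V" for v
    using that unfolding cardg by blast
  then have "regular_edges k V (g ` F)"
    using Fp gp by (auto simp: regular_edges_def)
  moreover have "bij_betw (\<phi> \<circ> g) (g ` F) I"
  proof -
    have "g ` g ` F = F"
      by (force simp: gg)
    then have "bij_betw g (g ` F) F"
      using injg by (auto simp: bij_betw_def inj_on_def)
    then show ?thesis
      using F(2) bij_betw_trans by blast
  qed
  moreover have "e \<in> E ((\<phi> \<circ> g) e)" if "e \<in> g ` F" for e
  proof -
    from that obtain e' where e': "e' \<in> F" "e = g e'"
      by auto
    have "g e' \<in> E (\<phi> e')"
    proof (rule gcases[of e'])
      fix z assume z: "z \<in> T" "e' = {x, z}"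
      then have "z \<in> X \<inter> T"
        using e' TV by (auto simp: X_def)
      then have "{x, z} \<notin> E (\<phi> {x, z})"
        unfolding XT by (simp add: Z_def)
      then show ?thesis
        using F(3)[OF e'(1)] z TV xy gx shift_target[of x y z] by auto
    next
      \<comment> \<open>An edge at \<open>y\<close> survives the shift only where
        \<open>{x, z}\<close> and \<open>{y, z}\<close> were both present, so completing
        \<open>Z\<close> by \<open>U\<close> costs nothing.\<close>
      fix z assume z: "z \<in> T" "e' = {y, z}"
      then show ?thesis
        using F(3)[OF e'(1)] TV xy gy shift_source[of x y z] by auto
    next
      assume g: "g e' = e'" "\<And>z. z \<in> T \<Longrightarrow> e' \<noteq> {x, z}"
      show ?thesis
      proof (cases "x \<in> e' \<or> y \<in> e'")
        case False
        then show ?thesis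
          using F(3)[OF e'(1)] xy g by (simp add: shift_off)
      next
        case True
        then have "e' \<in> {e \<in> F. x \<in> e} \<or> e' \<in> {e \<in> F. y \<in> e}"
          using e' by simp
        then consider "e' = {x, y}" | z where "z \<in> X" "e' = {x, z}" | z where "z \<in> Y" "e' = {y, z}"
          unfolding starx stary by auto
        then show ?thesis
        proof cases
          case 1
          then show ?thesis
            using F(3)[OF e'(1)] xy g by (simp add: shift_both)
        next
          case (2 z)
          then have "z \<notin> Z"
            using g XT by auto
          then show ?thesis
            using 2 g by (simp add: Z_def)
        next
          case (3 z)
          then have "z \<noteq> x" "z \<noteq> y"
            by (auto simp: Y_def)
          then show ?thesis
            using F(3)[OF e'(1)] 3 xy g shift_source[of x y z] by auto
        qed
      qed
    qed
    then show ?thesis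
      using e' gg by simp
  qed
  ultimately show ?thesis
    unfolding rainbow_def by blast
qed

section \<open>Rayleigh quotients of graphs\<close>

text \<open>Half the quadratic form of the adjacency matrix, see \<open>quad_double_sum\<close>. In
  the form of a sum over edges it can be compared with its shift edge by edge.\<close>

definition quad :: "'a set set \<Rightarrow> ('a \<Rightarrow> real) \<Rightarrow> real" where
  "quad E x = (\<Sum>e\<in>E. \<Prod>v\<in>e. x v)"

text \<open>Some nonnegative vector has Rayleigh quotient at least \<open>r\<close>. This replaces a
  bound on the spectral radius because a shift preserves it, with the same vector or with two of its
  entries exchanged.\<close>

definition heavy :: "'a set \<Rightarrow> real \<Rightarrow> 'a set set \<Rightarrow> bool" where
  "heavy V r E \<longleftrightarrow> (\<exists>u. (\<forall>v. 0 \<le> u v) \<and> (\<exists>v\<in>V. u v \<noteq> 0) \<and> r * (\<Sum>v\<in>V. (u v)\<^sup>2) \<le> 2 * quad E u)"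

lemma quad_double_sum:
  assumes V: "finite V" and E: "E \<subseteq> pairs V"
  shows "(\<Sum>u\<in>V. \<Sum>v\<in>V. of_bool ({u, v} \<in> E) * x u * x v) = 2 * quad E x"
proof -
  define D where "D = {p \<in> V \<times> V. {fst p, snd p} \<in> E}"
  have finE: "finite E"
    using finite_subset[OF E finite_pairs[OF V]] .
  have "(\<Sum>u\<in>V. \<Sum>v\<in>V. of_bool ({u, v} \<in> E) * x u * x v)
      = (\<Sum>p\<in>V \<times> V. of_bool ({fst p, snd p} \<in> E) * x (fst p) * x (snd p))"
    by (simp add: sum.cartesian_product split_beta)
  also have "\<dots> = (\<Sum>p\<in>D. x (fst p) * x (snd p))"
    using V unfolding D_def by (intro sum.mono_neutral_cong_right) auto
  also have "\<dots> = (\<Sum>e\<in>E. \<Sum>p\<in>{p\<in>D. {fst p, snd p} = e}. x (fst p) * x (snd p))"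
    using V finE by (intro sum.group[symmetric]) (auto simp: D_def)
  also have "\<dots> = (\<Sum>e\<in>E. 2 * (\<Prod>v\<in>e. x v))"
  proof (rule sum.cong)
    fix e assume e: "e \<in> E"
    then obtain a b where ab: "e = {a, b}" "a \<noteq> b" "a \<in> V" "b \<in> V"
      using E by (auto simp: pairs_def card_2_iff)
    have "{p\<in>D. {fst p, snd p} = e} = {(a, b), (b, a)}"
      using ab e by (auto simp: D_def doubleton_eq_iff insert_commute)
    then show "(\<Sum>p\<in>{p\<in>D. {fst p, snd p} = e}. x (fst p) * x (snd p)) = 2 * (\<Prod>v\<in>e. x v)"
      using ab by simp
  qed simp
  finally show ?thesis
    by (simp add: quad_def sum_distrib_left)
qed

lemma quad_shift_mono:
  assumes E: "E \<subseteq> pairs V" and u: "\<And>v. 0 \<le> u v" "u y \<le> u x" and "x \<noteq> y"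
  shows "quad E u \<le> quad (shift x y E) u"
proof -
  have "(\<Prod>v\<in>e. u v) \<le> (\<Prod>v\<in>shift_in x y E e. u v)" if "e \<in> E" for e
  proof (cases "y \<in> e \<and> x \<notin> e")
    case True
    then obtain z where z: "e = {y, z}" "z \<noteq> y" "z \<noteq> x"
      using E \<open>e \<in> E\<close> by (metis pairsE insert_iff subsetD)
    then have "shift_edge x y e = {x, z}"
      using \<open>x \<noteq> y\<close> by simp
    then show ?thesis
      using z u by (auto simp: shift_in_def mult_right_mono)
  qed (auto simp: shift_in_def shift_edge_def)
  then show ?thesis
    unfolding quad_def shift_eq_image[OF \<open>x \<noteq> y\<close>]
    by (subst sum.reindex[OF inj_on_shift_in[OF \<open>x \<noteq> y\<close>]]) (auto intro!: sum_mono)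
qed

text \<open>Both shifts give one of \<open>x\<close>, \<open>y\<close> the union and the other the
  intersection of the neighbourhoods, so they differ by exchanging the two vertices. This settles
  test vectors that are larger at \<open>y\<close>: shift the other way and rename.\<close>

lemma shift_swap:
  assumes E: "E \<subseteq> pairs V" and xy: "x \<in> V" "y \<in> V" "x \<noteq> y"
  shows "shift x y E = (`) (transpose x y) ` shift y x E"
proof -
  have key: "e \<in> shift x y E \<longleftrightarrow> transpose x y ` e \<in> shift y x E" if e: "e \<in> pairs V" for e
  proof -
    have tr: "transpose x y ` {a, z} = {b, z}" if "{a, b} = {x, y}" "z \<noteq> x" "z \<noteq> y" for a b z
      using that by (auto simp: doubleton_eq_iff)
    consider "e = {x, y}" | z where "e = {x, z}" "z \<noteq> x" "z \<noteq> y" | z where "e = {y, z}" "z \<noteq> x" "z \<noteq> y"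
      | "x \<notin> e" "y \<notin> e"
      using e by (metis pairsE insert_commute)
    then show ?thesis
    proof cases
      case 1
      then have "transpose x y ` e = {y, x}" by simp
      moreover have "{y, x} = {x, y}" by auto
      ultimately show ?thesis
        using 1 xy shift_both[of x y E] shift_both[of y x E] by simp
    next
      case (2 z)
      then have "transpose x y ` e = {y, z}"
        by (simp add: tr)
      then show ?thesis
        using 2 xy by (simp add: shift_target disj_commute)
    next
      case (3 z)
      then have "transpose x y ` e = {x, z}"
        by (simp add: tr insert_commute)
      then show ?thesis
        using 3 xy by (simp add: shift_source conj_commute)
    next
      case 4
      then have "transpose x y ` e = e"
        by (auto simp: transpose_def image_iff)
      then show ?thesis
        using 4 xy by (simp add: shift_off)
    qed
  qed
  have inv: "transpose x y ` transpose x y ` e = e" for e :: "'a set"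
    by (simp add: image_image)
  have sub: "shift x y E \<subseteq> pairs V" "shift y x E \<subseteq> pairs V"
    using E xy by (auto dest: shift_pairs)
  have tp: "transpose x y ` e \<in> pairs V" if "e \<in> pairs V" for e
    using that xy card_image[OF inj_on_subset[OF inj_transpose subset_UNIV], of x y e]
    by (auto simp: pairs_def transpose_def)
  show ?thesis
  proof (intro Set.set_eqI iffI)
    fix e assume "e \<in> shift x y E"
    then have "transpose x y ` e \<in> shift y x E"
      using key sub by blast
    then show "e \<in> (`) (transpose x y) ` shift y x E"
      by (rule rev_image_eqI) (simp add: inv)
  next
    fix e assume "e \<in> (`) (transpose x y) ` shift y x E"
    then obtain d where d: "d \<in> shift y x E" "e = transpose x y ` d"
      by blast
    then have "e \<in> pairs V" "transpose x y ` e = d"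
      using sub tp inv by auto
    then show "e \<in> shift x y E"
      using key d by simp
  qed
qed

lemma heavy_shift:
  assumes V: "finite V" and E: "E \<subseteq> pairs V" and xy: "x \<in> V" "y \<in> V" "x \<noteq> y"
    and hv: "heavy V r E"
  shows "heavy V r (shift x y E)"
proof -
  obtain u where u: "\<And>v. 0 \<le> u v" "\<exists>v\<in>V. u v \<noteq> 0" "r * (\<Sum>v\<in>V. (u v)\<^sup>2) \<le> 2 * quad E u"
    using hv by (auto simp: heavy_def)
  show ?thesis
  proof (cases "u y \<le> u x")
    case True
    then have "quad E u \<le> quad (shift x y E) u"
      using quad_shift_mono[OF E u(1) _ xy(3)] by simp
    then have "r * (\<Sum>v\<in>V. (u v)\<^sup>2) \<le> 2 * quad (shift x y E) u"
      using u(3) by linarith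
    then show ?thesis
      using u unfolding heavy_def by blast
  next
    case False
    then have *: "quad E u \<le> quad (shift y x E) u"
      using quad_shift_mono[OF E u(1), where x = y and y = x] xy by simp
    let ?t = "transpose x y"
    have bij: "bij_betw ?t V V"
      using xy by (intro bij_betw_byWitness[where f' = ?t]) (auto simp: transpose_def)
    have "inj_on ((`) ?t) (shift y x E)"
      by (meson inj_image_eq_iff inj_onI inj_transpose)
    then have "quad (shift x y E) (u \<circ> ?t) = (\<Sum>e\<in>shift y x E. \<Prod>v\<in>?t ` e. u (?t v))"
      unfolding quad_def shift_swap[OF E xy] by (simp add: sum.reindex)
    also have "\<dots> = quad (shift y x E) u"
      unfolding quad_def by (intro sum.cong refl) (simp add: prod.reindex inj_on_subset[OF inj_transpose])
    finally have 1: "quad (shift x y E) (u \<circ> ?t) = quad (shift y x E) u" .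
    have 2: "(\<Sum>v\<in>V. ((u \<circ> ?t) v)\<^sup>2) = (\<Sum>v\<in>V. (u v)\<^sup>2)"
      using sum.reindex_bij_betw[OF bij, of "\<lambda>v. (u v)\<^sup>2"] by simp
    have 3: "\<exists>v\<in>V. (u \<circ> ?t) v \<noteq> 0"
    proof -
      obtain v where "v \<in> V" "u v \<noteq> 0"
        using u(2) by blast
      then have "?t v \<in> V" "(u \<circ> ?t) (?t v) \<noteq> 0"
        using bij by (auto simp: bij_betw_def)
      then show ?thesis by blast
    qed
    have "r * (\<Sum>v\<in>V. ((u \<circ> ?t) v)\<^sup>2) \<le> 2 * quad (shift x y E) (u \<circ> ?t)"
      unfolding 1 2 using u(3) * by linarith
    moreover have "\<forall>v. 0 \<le> (u \<circ> ?t) v"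
      using u(1) by simp
    ultimately show ?thesis
      using 3 unfolding heavy_def by blast
  qed
qed

text \<open>Hong's argument: from \<open>r \<bar>u\<bar> \<le> \<bar>A u\<bar>\<close> and Cauchy-Schwarz in every row, \<open>r\<^sup>2\<close> is at most a weighted
  average, with weights \<open>(u w)\<^sup>2\<close>, of the degree sums over the neighbourhoods of \<open>w\<close>. Such a sum falls short of
  \<open>2 m\<close> by the degree of \<open>w\<close> itself and by at least one for every non-neighbour.\<close>

lemma heavy_imp_many_edges:
  assumes V: "finite V" and E: "E \<subseteq> pairs V" and r: "0 \<le> r" and hv: "heavy V r E"
    and iso: "\<And>v. v \<in> V \<Longrightarrow> \<exists>w. {v, w} \<in> E"
  shows "r\<^sup>2 + real (card V) - 1 \<le> 2 * real (card E)"
proof -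
  obtain u where u: "\<exists>v\<in>V. u v \<noteq> 0" "r * (\<Sum>v\<in>V. (u v)\<^sup>2) \<le> 2 * quad E u"
    using hv by (auto simp: heavy_def)
  define a :: "'a \<Rightarrow> 'a \<Rightarrow> real" where "a v w = of_bool ({v, w} \<in> E)" for v w
  define A where "A v = (\<Sum>w\<in>V. a v w * u w)" for v
  define d where "d v = (\<Sum>w\<in>V. a v w)" for v
  define S where "S = (\<Sum>v\<in>V. (u v)\<^sup>2)"
  have S: "S > 0"
    using u(1) V unfolding S_def by (auto intro!: sum_pos2)
  have sym: "a v w = a w v" for v w
    by (simp add: a_def insert_commute)
  have a01: "a v w = 0 \<or> a v w = 1" for v w
    by (simp add: a_def)
  have "r * S \<le> (\<Sum>v\<in>V. u v * A v)"
    using u(2) quad_double_sum[OF V E, of u]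
    by (simp add: S_def A_def a_def sum_distrib_left mult_ac)
  \<comment> \<open>Expanding the squared norm of \<open>A u - r u\<close> turns the Rayleigh
    quotient into a lower bound for the norm of \<open>A u\<close>, without \<open>u\<close> being
    an eigenvector.\<close>
  moreover have "0 \<le> (\<Sum>v\<in>V. (A v - r * u v)\<^sup>2)"
    by (simp add: sum_nonneg)
  moreover have "(\<Sum>v\<in>V. (A v - r * u v)\<^sup>2) = (\<Sum>v\<in>V. (A v)\<^sup>2) - 2 * r * (\<Sum>v\<in>V. u v * A v) + r\<^sup>2 * S"
    by (simp add: S_def power2_diff power_mult_distrib sum.distrib sum_subtractf sum_distrib_left mult_ac)
  ultimately have 1: "r\<^sup>2 * S \<le> (\<Sum>v\<in>V. (A v)\<^sup>2)"
    using mult_left_mono[OF \<open>r * S \<le> _\<close> r] by (simp add: power2_eq_square mult_ac)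
  have 2: "(A v)\<^sup>2 \<le> d v * (\<Sum>w\<in>V. a v w * (u w)\<^sup>2)" for v
  proof -
    define N where "N = {w\<in>V. {v, w} \<in> E}"
    have N: "(\<Sum>w\<in>V. a v w * f w) = (\<Sum>w\<in>N. f w)" for f
      using V unfolding N_def a_def by (intro sum.mono_neutral_cong_right) auto
    have "d v = card N"
      using N[of "\<lambda>_. 1"] by (simp add: d_def)
    moreover have "(\<Sum>w\<in>N. u w)\<^sup>2 \<le> card N * (\<Sum>w\<in>N. (u w)\<^sup>2)"
      using sum_squared_le_sum_of_squares[of u N] by (simp add: mult.commute)
    ultimately show ?thesis
      by (simp add: A_def N)
  qed
  have dsum: "(\<Sum>v\<in>V. d v) = 2 * real (card E)"
    using quad_double_sum[OF V E, of "\<lambda>_. 1"] by (simp add: d_def a_def quad_def)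
  have d1: "1 \<le> d v" if "v \<in> V" for v
  proof -
    obtain w where w: "{v, w} \<in> E"
      using iso \<open>v \<in> V\<close> by blast
    then have "w \<in> V"
      using E by (auto simp: pairs_def)
    then have "a v w \<le> d v"
      unfolding d_def using V by (intro member_le_sum) (auto simp: a_def)
    then show ?thesis
      using w by (simp add: a_def)
  qed
  have 3: "(\<Sum>v\<in>V. d v * a v w) \<le> 2 * real (card E) - (real (card V) - 1)" if w: "w \<in> V" for w
  proof -
    have aww: "a w w = 0"
      using E by (auto simp: a_def pairs_def)
    have "real (card V) - 1 = (\<Sum>v\<in>V-{w}. 1)"
      using w V by (simp add: card_gt_0_iff Suc_leI)
        (metis One_nat_def Suc_leI card_gt_0_iff empty_iff of_nat_1 of_nat_diff)
    also have "\<dots> \<le> (\<Sum>v\<in>V-{w}. d v * (1 - a v w) + a w v)"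
    proof (rule sum_mono)
      fix v assume "v \<in> V - {w}"
      then show "1 \<le> d v * (1 - a v w) + a w v"
        using d1[of v] a01[of v w] by (auto simp: sym[of w v])
    qed
    also have "\<dots> = (\<Sum>v\<in>V-{w}. d v * (1 - a v w)) + d w"
      using w V aww by (simp add: sum.distrib d_def sum.remove[of V w "a w"])
    also have "\<dots> = (\<Sum>v\<in>V. d v * (1 - a v w))"
      using w V aww by (simp add: sum.remove[of V w "\<lambda>v. d v * (1 - a v w)"])
    also have "\<dots> = 2 * real (card E) - (\<Sum>v\<in>V. d v * a v w)"
      unfolding dsum[symmetric] by (simp add: right_diff_distrib sum_subtractf)
    finally show ?thesis by simp
  qed
  have "(\<Sum>v\<in>V. (A v)\<^sup>2) \<le> (\<Sum>v\<in>V. d v * (\<Sum>w\<in>V. a v w * (u w)\<^sup>2))"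
    using 2 by (intro sum_mono) auto
  also have "\<dots> = (\<Sum>w\<in>V. (u w)\<^sup>2 * (\<Sum>v\<in>V. d v * a v w))"
    by (simp add: sum_distrib_left mult_ac) (subst sum.swap, simp)
  also have "\<dots> \<le> (\<Sum>w\<in>V. (u w)\<^sup>2 * (2 * real (card E) - (real (card V) - 1)))"
    using 3 by (intro sum_mono mult_left_mono) auto
  also have "\<dots> = (2 * real (card E) - (real (card V) - 1)) * S"
    by (simp add: S_def sum_distrib_right[symmetric] mult.commute)
  finally have "r\<^sup>2 * S \<le> (2 * real (card E) - (real (card V) - 1)) * S"
    using 1 by linarith
  then show ?thesis
    using S by (simp add: mult_le_cancel_right)
qed

section \<open>Maximisers of a quadratic form are eigenvectors\<close>

text \<open>First-order condition at a maximiser: moving \<open>u\<close> by \<open>t\<close> along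
  one coordinate leaves a linear term \<open>2 * t * c\<close> that a quadratic one must dominate
  for all \<open>t\<close>, so the defect \<open>c\<close> of the eigenvalue equation in that
  coordinate vanishes.\<close>

lemma rayleigh_eigen:
  fixes a :: "'a \<Rightarrow> 'a \<Rightarrow> real"
  assumes V: "finite V" and sym: "\<And>i j. a i j = a j i"
    and le: "\<And>x. (\<Sum>i\<in>V. \<Sum>j\<in>V. a i j * x i * x j) \<le> M * (\<Sum>i\<in>V. (x i)\<^sup>2)"
    and eq: "(\<Sum>i\<in>V. \<Sum>j\<in>V. a i j * u i * u j) = M * (\<Sum>i\<in>V. (u i)\<^sup>2)"
    and v: "v \<in> V"
  shows "(\<Sum>j\<in>V. a v j * u j) = M * u v"
proof -
  define c where "c = (\<Sum>j\<in>V. a v j * u j) - M * u v"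
  define D :: "'a \<Rightarrow> real" where "D i = of_bool (i = v)" for i
  have D: "(\<Sum>i\<in>V. D i * f i) = f v" for f
    using V v by (simp add: D_def of_bool_def if_distrib[of "\<lambda>x. x * _"] cong: if_cong)
  have *: "2 * t * c \<le> (M - a v v) * t\<^sup>2" for t
  proof -
    define x where "x i = u i + t * D i" for i
    have "(\<Sum>i\<in>V. \<Sum>j\<in>V. a i j * x i * x j)
        = (\<Sum>i\<in>V. \<Sum>j\<in>V. a i j * u i * u j) + t * (\<Sum>i\<in>V. \<Sum>j\<in>V. D j * (a i j * u i))
          + t * (\<Sum>i\<in>V. \<Sum>j\<in>V. D i * (a i j * u j)) + t\<^sup>2 * (\<Sum>i\<in>V. \<Sum>j\<in>V. D j * (D i * a i j))"
      by (simp add: x_def algebra_simps sum.distrib sum_distrib_left power2_eq_square)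
    also have "(\<Sum>i\<in>V. \<Sum>j\<in>V. D j * (a i j * u i)) = (\<Sum>j\<in>V. a v j * u j)"
      by (simp add: D sym[of _ v])
    also have "(\<Sum>i\<in>V. \<Sum>j\<in>V. D i * (a i j * u j)) = (\<Sum>j\<in>V. a v j * u j)"
      by (simp add: sum_distrib_left[symmetric] D)
    also have "(\<Sum>i\<in>V. \<Sum>j\<in>V. D j * (D i * a i j)) = a v v"
      by (simp add: D)
    finally have 1: "(\<Sum>i\<in>V. \<Sum>j\<in>V. a i j * x i * x j)
      = M * (\<Sum>i\<in>V. (u i)\<^sup>2) + 2 * t * (\<Sum>j\<in>V. a v j * u j) + t\<^sup>2 * a v v"
      by (simp add: eq)
    have "(\<Sum>i\<in>V. (x i)\<^sup>2) = (\<Sum>i\<in>V. (u i)\<^sup>2) + 2 * t * (\<Sum>i\<in>V. D i * u i) + t\<^sup>2 * (\<Sum>i\<in>V. D i * D i)"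
      by (simp add: x_def power2_eq_square algebra_simps sum.distrib sum_distrib_left)
    also have "\<dots> = (\<Sum>i\<in>V. (u i)\<^sup>2) + 2 * t * u v + t\<^sup>2"
      by (simp add: D) (simp add: D_def)
    finally show ?thesis
      using le[of x] unfolding 1 c_def by (simp add: distrib_left left_diff_distrib right_diff_distrib mult.commute mult.left_commute)
  qed
  \<comment> \<open>\<open>q\<close> is positive and dominates \<open>M - a v v\<close>, so the
    choice \<open>t = c / q\<close> yields \<open>c * c / q \<le> 0\<close>.\<close>
  define q where "q = \<bar>M - a v v\<bar> + 1"
  have q: "q > 0" "M - a v v \<le> q"
    by (auto simp: q_def)
  have "2 * (c / q) * c \<le> (M - a v v) * (c / q)\<^sup>2"
    by (rule *)
  also have "\<dots> \<le> q * (c / q)\<^sup>2"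
    using q by (intro mult_right_mono) auto
  also have "\<dots> = (c / q) * c"
    using q by (simp add: power2_eq_square)
  finally have "c * c / q \<le> 0"
    by simp
  then have "c = 0"
    using q by (simp add: divide_le_0_iff) (metis mult_eq_0_iff not_sum_squares_lt_zero order_le_less zero_le_square antisym)
  then show ?thesis
    by (simp add: c_def)
qed

lemma rayleigh_max:
  fixes a :: "'a \<Rightarrow> 'a \<Rightarrow> real"
  assumes V: "finite V" "V \<noteq> {}"
  obtains u M where "(\<Sum>i\<in>V. (u i)\<^sup>2) = 1"
    "\<forall>x. (\<Sum>i\<in>V. \<Sum>j\<in>V. a i j * x i * x j) \<le> M * (\<Sum>i\<in>V. (x i)\<^sup>2)"
    "(\<Sum>i\<in>V. \<Sum>j\<in>V. a i j * u i * u j) = M * (\<Sum>i\<in>V. (u i)\<^sup>2)"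
proof -
  define Q where "Q x = (\<Sum>i\<in>V. \<Sum>j\<in>V. a i j * x i * x j)" for x :: "'a \<Rightarrow> real"
  define S where "S x = (\<Sum>i\<in>V. (x i)\<^sup>2)" for x :: "'a \<Rightarrow> real"
  \<comment> \<open>Vectors are functions on the whole type; pinning the coordinates outside
    \<open>V\<close> to 0 makes \<open>B\<close> a product of compact sets, hence compact, and with
    it the unit sphere \<open>K\<close>.\<close>
  define B where "B = (\<Pi>\<^sub>E i\<in>UNIV. if i \<in> V then {-1..1::real} else {0})"
  define K where "K = B \<inter> {x. S x = 1}"
  have "compactin (product_topology (\<lambda>i. euclidean) UNIV) B"
    unfolding B_def by (subst compactin_PiE) auto
  then have "compact B"
    by (simp add: euclidean_product_topology)
  moreover have contS: "continuous_on UNIV S" and contQ: "continuous_on UNIV Q"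
    unfolding S_def Q_def by (intro continuous_intros continuous_on_product_coordinates)+
  moreover have "closed {x. S x = 1}"
    using contS by (intro closed_Collect_eq) auto
  ultimately have "compact K"
    unfolding K_def by (intro compact_Int_closed)
  obtain v where v: "v \<in> V"
    using V by blast
  have "(\<lambda>i. of_bool (i = v)) \<in> K"
    using v V by (simp add: K_def B_def S_def PiE_UNIV_domain Pi_iff of_bool_def if_distrib[of "\<lambda>x. x ^ _"] cong: if_cong)
  then obtain u where u: "u \<in> K" "\<And>x. x \<in> K \<Longrightarrow> Q x \<le> Q u"
    using continuous_attains_sup[of K Q] \<open>compact K\<close> continuous_on_subset[OF contQ] by blast
  have Su: "S u = 1"
    using u(1) by (simp add: K_def)
  have "Q x \<le> Q u * S x" for x
  proof (cases "S x = 0")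
    case True
    then have "x i = 0" if "i \<in> V" for i
      using V that by (simp add: S_def sum_nonneg_eq_0_iff)
    then show ?thesis
      using True by (simp add: Q_def)
  next
    case False
    then have pos: "S x > 0"
      by (simp add: S_def order_less_le sum_nonneg)
    define y where "y i = (if i \<in> V then x i / sqrt (S x) else 0)" for i
    have "S y = S x / S x"
      using pos by (simp add: S_def[of y] y_def power_divide sum_divide_distrib[symmetric]) (simp add: S_def)
    then have Sy: "S y = 1"
      using False by simp
    have "\<bar>y i\<bar> \<le> 1" if "i \<in> V" for i
    proof -
      have "(y i)\<^sup>2 \<le> S y"
        unfolding S_def using V that by (intro member_le_sum) auto
      then show ?thesis
        by (simp add: Sy abs_square_le_1)
    qed
    then have "y \<in> K"
      using Sy by (auto simp: K_def B_def PiE_UNIV_domain Pi_iff abs_le_iff minus_le_iff) (simp add: y_def)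
    then have "Q y \<le> Q u"
      by (rule u)
    moreover have "Q y = Q x / S x"
    proof -
      have "Q y = (\<Sum>i\<in>V. \<Sum>j\<in>V. a i j * x i * x j / S x)"
        unfolding Q_def using pos by (intro sum.cong refl) (simp add: y_def)
      then show ?thesis
        by (simp add: Q_def sum_divide_distrib)
    qed
    ultimately show ?thesis
      using pos by (simp add: field_simps)
  qed
  then show ?thesis
    using Su by (intro that[of u "Q u"]) (auto simp only: S_def Q_def mult_1_right)
qed

section \<open>Construction of regular graphs\<close>

lemma card_star:
  assumes "F \<subseteq> pairs V"
  shows "card {e \<in> F. v \<in> e} = card {w. {v, w} \<in> F}"
proof -
  have "{e \<in> F. v \<in> e} = (\<lambda>w. {v, w}) ` {w. {v, w} \<in> F}"
  proof (intro Set.set_eqI iffI)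
    fix e assume e: "e \<in> {e \<in> F. v \<in> e}"
    then obtain w where "e = {v, w}"
      using assms by (auto elim: pairsE)
    then show "e \<in> (\<lambda>w. {v, w}) ` {w. {v, w} \<in> F}"
      using e by auto
  qed auto
  moreover have "inj_on (\<lambda>w. {v, w}) A" for A
    by (auto simp: inj_on_def doubleton_eq_iff)
  ultimately show ?thesis
    by (simp add: card_image)
qed

lemma bij_betw_extend:
  assumes "finite V" "finite W" "card V = card W" "S \<subseteq> V" "inj_on g S" "g ` S \<subseteq> W"
  obtains p where "bij_betw p V W" "\<And>s. s \<in> S \<Longrightarrow> p s = g s"
proof -
  have fin: "finite S"
    using assms finite_subset by blast
  have "card (V - S) = card (W - g ` S)"
    using assms fin by (simp add: card_Diff_subset card_image)
  then obtain q where q: "bij_betw q (V - S) (W - g ` S)"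
    using assms by (metis finite_Diff finite_same_card_bij)
  define p where "p v = (if v \<in> S then g v else q v)" for v
  have "bij_betw p S (g ` S)"
    using assms(5) by (auto simp: p_def bij_betw_def inj_on_def)
  moreover have "bij_betw p (V - S) (W - g ` S)"
    using q by (rule bij_betw_cong[THEN iffD1, rotated]) (simp add: p_def)
  ultimately have "bij_betw p (S \<union> (V - S)) (g ` S \<union> (W - g ` S))"
    by (rule bij_betw_combine) auto
  moreover have "S \<union> (V - S) = V" "g ` S \<union> (W - g ` S) = W"
    using assms by auto
  ultimately have "bij_betw p V W" by simp
  then show ?thesis
    by (rule that) (simp add: p_def)
qed

lemma regular_edges_image:
  assumes p: "bij_betw p V W" and F: "regular_edges k V F"
  shows "regular_edges k W ((`) p ` F)"
    and "\<And>u v. u \<in> V \<Longrightarrow> v \<in> V \<Longrightarrow> {p u, p v} \<in> (`) p ` F \<longleftrightarrow> {u, v} \<in> F"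
proof -
  have inj: "inj_on p V" and im: "p ` V = W"
    using p by (auto simp: bij_betw_def)
  have Fp: "F \<subseteq> pairs V"
    using F by (simp add: regular_edges_def)
  have FV: "e \<subseteq> V" if "e \<in> F" for e
    using that Fp by (auto simp: pairs_def)
  have mem: "p v \<in> p ` e \<longleftrightarrow> v \<in> e" if "v \<in> V" "e \<in> F" for v e
    using inj that FV by (meson inj_on_image_mem_iff)
  have injF: "inj_on ((`) p) F"
    using inj FV by (meson inj_onI inj_on_image_eq_iff)
  have "card {e \<in> (`) p ` F. p v \<in> e} = k" if "v \<in> V" for v
  proof -
    have "{e \<in> (`) p ` F. p v \<in> e} = (`) p ` {e \<in> F. v \<in> e}"
      using mem[OF that] by auto
    then have "card {e \<in> (`) p ` F. p v \<in> e} = card {e \<in> F. v \<in> e}"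
      using card_image[OF inj_on_subset[OF injF, of "{e \<in> F. v \<in> e}"]] by auto
    then show ?thesis
      using F that by (simp add: regular_edges_def)
  qed
  moreover have "(`) p ` F \<subseteq> pairs W"
  proof
    fix e assume "e \<in> (`) p ` F"
    then obtain d where d: "d \<in> F" "e = p ` d"
      by blast
    then show "e \<in> pairs W"
      using Fp FV[OF d(1)] im card_image[OF inj_on_subset[OF inj, of d]] by (auto simp: pairs_def)
  qed
  ultimately show "regular_edges k W ((`) p ` F)"
    unfolding regular_edges_def im[symmetric] by blast
  fix u v assume uv: "u \<in> V" "v \<in> V"
  have "p ` {u, v} \<in> (`) p ` F \<longleftrightarrow> {u, v} \<in> F"
  proof
    assume "p ` {u, v} \<in> (`) p ` F"
    then obtain d where d: "d \<in> F" "p ` {u, v} = p ` d"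
      by blast
    then have "{u, v} = d"
      using inj_on_image_eq_iff[OF inj, of "{u, v}" d] uv FV by auto
    then show "{u, v} \<in> F"
      using d by simp
  qed blast
  then show "{p u, p v} \<in> (`) p ` F \<longleftrightarrow> {u, v} \<in> F"
    by simp
qed

text \<open>All but two edges of \<open>F\<close> lie in every graph, so only these two constrain
  the colouring, and any bijection that extends their prescribed colours works. Every rainbow factor
  written down below is coloured this way.\<close>

lemma rainbow_two_special:
  assumes V: "finite V" "finite I" "2 * card I = k * card V" and F: "regular_edges k V F"
    and e: "e \<in> F" "e' \<in> F" "e \<noteq> e'" and i: "i \<in> I" "i' \<in> I" "i \<noteq> i'"
    and E: "e \<in> E i" "e' \<in> E i'"
      "\<And>d j. d \<in> F \<Longrightarrow> d \<noteq> e \<Longrightarrow> d \<noteq> e' \<Longrightarrow> j \<in> I \<Longrightarrow> d \<in> E j"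
  shows "rainbow k V I E"
proof -
  have finF: "finite F"
    using F V finite_pairs finite_subset by (auto simp: regular_edges_def)
  have "card F = card I"
    using regular_edges_card[OF V(1) F] V(3) by simp
  moreover have "inj_on (\<lambda>d. if d = e then i else i') {e, e'}"
    using i e by auto
  moreover have "(\<lambda>d. if d = e then i else i') ` {e, e'} \<subseteq> I"
    using i by auto
  ultimately obtain p where p: "bij_betw p F I"
    "\<And>s. s \<in> {e, e'} \<Longrightarrow> p s = (if s = e then i else i')"
    using bij_betw_extend[OF finF V(2), of "{e, e'}" "\<lambda>d. if d = e then i else i'"] e by auto
  have "d \<in> E (p d)" if "d \<in> F" for d
    using p(2)[of d] E e that bij_betwE[OF p(1)] by (cases "d = e \<or> d = e'") auto
  then show ?thesis
    using F p(1) unfolding rainbow_def by blast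
qed

text \<open>The vertices are \<open>i + 1\<close> and \<open>n - j\<close> for \<open>i, j < h\<close>, joined by a circulant bipartite graph,
  and for odd \<open>n\<close> additionally \<open>h + 1\<close>, which subdivides a matching of \<open>k / 2\<close> edges \<open>{i + 1, n - i}\<close>.\<close>

lemma exists_low_factor:
  fixes n k :: nat
  assumes k: "k \<ge> 1" and n: "n \<ge> 4 * k - 1" and kn: "even (k * n)"
  obtains F where "regular_edges k {1..n} F" "{w. {n, w} \<in> F} = {1..k}" "{w. {n - 1, w} \<in> F} = {2..k+1}"
    "\<And>i j. {i, j} \<in> F \<Longrightarrow> i < j \<Longrightarrow>
      j = n \<and> i \<le> k \<or> i \<le> n div 2 \<and> j \<le> n - 1 \<or> 2 * i = n + 1 \<and> j \<le> n - 2"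
proof -
  define h where "h = n div 2"
  \<comment> \<open>For odd \<open>n\<close> the number \<open>k\<close> is even, and
    \<open>k div 2\<close> subdivided edges give the middle vertex degree \<open>k\<close>. Starting
    at 2 leaves the neighbourhoods of \<open>n\<close> and \<open>n - 1\<close>, that is
    \<open>j = 0\<close> and \<open>j = 1\<close>, untouched.\<close>
  define M where "M = (if even n then {} else {2..<k div 2 + 2})"
  \<comment> \<open>The residue of \<open>i - j\<close> modulo \<open>h\<close>. With
    \<open>i\<close> or \<open>j\<close> fixed it permutes \<open>{..<h}\<close>, so exactly
    \<open>k\<close> of its values lie below \<open>k\<close>.\<close>
  define d where "d i j = (if j \<le> i then i - j else i + h - j)" for i j
  define F where "F = {{i + 1, n - j} | i j. i < h \<and> j < h \<and> d i j < k \<and> \<not> (i = j \<and> i \<in> M)}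
    \<union> (\<lambda>i. {h + 1, i + 1}) ` M \<union> (\<lambda>i. {h + 1, n - i}) ` M"
  have kh: "k + 1 \<le> h" and h2: "2 \<le> h"
  proof -
    have "k + 1 \<le> h \<and> 2 \<le> h"
    proof (cases "k = 1")
      case True
      then have "even n" "3 \<le> n"
        using n kn by auto
      then have "4 \<le> n" by presburger
      then show ?thesis using True by (auto simp: h_def)
    qed (use k n in \<open>auto simp: h_def\<close>)
    then show "k + 1 \<le> h" "2 \<le> h" by auto
  qed
  have hn: "even n \<Longrightarrow> n = 2 * h" "odd n \<Longrightarrow> n = 2 * h + 1"
    by (auto simp: h_def)
  have nh: "2 * h \<le> n" "n \<le> 2 * h + 1"
    by (auto simp: h_def)
  have M: "odd n" "even k" "i < h" "2 \<le> i" "n = 2 * h + 1" if "i \<in> M" for i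
  proof -
    show "odd n" "2 \<le> i"
      using that by (auto simp: M_def split: if_splits)
    then show "even k" "n = 2 * h + 1"
      using kn hn by auto
    have "k div 2 + 2 \<le> h"
      using \<open>odd n\<close> \<open>even k\<close> k n by (auto simp: h_def elim!: oddE evenE)
    then show "i < h"
      using that by (auto simp: M_def split: if_splits)
  qed
  have finM: "finite M" by (simp add: M_def)
  have cardM: "odd n \<Longrightarrow> 2 * card M = k"
    using kn by (simp add: M_def)
  have nb: "{n - j, w} \<in> F \<longleftrightarrow> (\<exists>i<h. w = i + 1 \<and> d i j < k \<and> \<not> (i = j \<and> i \<in> M)) \<or> w = h + 1 \<and> j \<in> M"
    if j: "j < h" for j w
  proof
    assume "{n - j, w} \<in> F"
    then consider (1) i' j' where "{n - j, w} = {i' + 1, n - j'}" "i' < h" "j' < h" "d i' j' < k" "\<not> (i' = j' \<and> i' \<in> M)"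
      | (2) i' where "{n - j, w} = {h + 1, i' + 1}" "i' \<in> M" | (3) i' where "{n - j, w} = {h + 1, n - i'}" "i' \<in> M"
      unfolding F_def by auto
    then show "(\<exists>i<h. w = i + 1 \<and> d i j < k \<and> \<not> (i = j \<and> i \<in> M)) \<or> w = h + 1 \<and> j \<in> M"
    proof cases
      case 1
      then have "n - j = n - j'" "w = i' + 1"
        using j nh by (auto simp: doubleton_eq_iff)
      then have "j = j'" using j 1 nh by auto
      then show ?thesis using 1 \<open>w = _\<close> by blast
    next
      case 2
      then show ?thesis
        using j nh M[OF 2(2)] by (auto simp: doubleton_eq_iff)
    next
      case 3
      then have "n - j = n - i'" "w = h + 1"
        using j nh M[OF 3(2)] by (auto simp: doubleton_eq_iff)
      then have "j = i'" using j nh M[OF 3(2)] by auto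
      then show ?thesis using 3 \<open>w = _\<close> by blast
    qed
  next
    assume "(\<exists>i<h. w = i + 1 \<and> d i j < k \<and> \<not> (i = j \<and> i \<in> M)) \<or> w = h + 1 \<and> j \<in> M"
    then show "{n - j, w} \<in> F"
    proof
      assume "\<exists>i<h. w = i + 1 \<and> d i j < k \<and> \<not> (i = j \<and> i \<in> M)"
      then obtain i where "i < h" "w = i + 1" "d i j < k" "\<not> (i = j \<and> i \<in> M)" by blast
      moreover have "{n - j, w} = {w, n - j}" by auto
      ultimately show ?thesis unfolding F_def using j by blast
    next
      assume "w = h + 1 \<and> j \<in> M"
      moreover have "{n - j, w} = {w, n - j}" by auto
      ultimately show ?thesis unfolding F_def by blast
    qed
  qed
  have na: "{i + 1, w} \<in> F \<longleftrightarrow> (\<exists>j<h. w = n - j \<and> d i j < k \<and> \<not> (i = j \<and> i \<in> M)) \<or> w = h + 1 \<and> i \<in> M"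
    if i: "i < h" for i w
  proof
    assume "{i + 1, w} \<in> F"
    then consider (1) i' j' where "{i + 1, w} = {i' + 1, n - j'}" "i' < h" "j' < h" "d i' j' < k" "\<not> (i' = j' \<and> i' \<in> M)"
      | (2) i' where "{i + 1, w} = {h + 1, i' + 1}" "i' \<in> M" | (3) i' where "{i + 1, w} = {h + 1, n - i'}" "i' \<in> M"
      unfolding F_def by auto
    then show "(\<exists>j<h. w = n - j \<and> d i j < k \<and> \<not> (i = j \<and> i \<in> M)) \<or> w = h + 1 \<and> i \<in> M"
    proof cases
      case 1
      then have "i = i'" "w = n - j'"
        using i nh by (auto simp: doubleton_eq_iff)
      then show ?thesis using 1 by blast
    next
      case 2
      then show ?thesis
        using i nh M[OF 2(2)] by (auto simp: doubleton_eq_iff)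
    next
      case 3
      then show ?thesis
        using i nh M[OF 3(2)] by (auto simp: doubleton_eq_iff)
    qed
  next
    assume "(\<exists>j<h. w = n - j \<and> d i j < k \<and> \<not> (i = j \<and> i \<in> M)) \<or> w = h + 1 \<and> i \<in> M"
    then show "{i + 1, w} \<in> F"
    proof
      assume "\<exists>j<h. w = n - j \<and> d i j < k \<and> \<not> (i = j \<and> i \<in> M)"
      then show ?thesis unfolding F_def using i by blast
    next
      assume "w = h + 1 \<and> i \<in> M"
      moreover have "{i + 1, w} = {w, i + 1}" by auto
      ultimately show ?thesis unfolding F_def by blast
    qed
  qed
  have nc: "{w. {h + 1, w} \<in> F} = (\<lambda>i. i + 1) ` M \<union> (\<lambda>i. n - i) ` M" if "odd n"
  proof (intro Set.set_eqI iffI)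
    fix w assume "w \<in> {w. {h + 1, w} \<in> F}"
    then have "{h + 1, w} \<in> F" by simp
    then consider (1) i' j' where "{h + 1, w} = {i' + 1, n - j'}" "i' < h" "j' < h"
      | (2) i' where "{h + 1, w} = {h + 1, i' + 1}" "i' \<in> M" | (3) i' where "{h + 1, w} = {h + 1, n - i'}" "i' \<in> M"
      unfolding F_def by auto
    then show "w \<in> (\<lambda>i. i + 1) ` M \<union> (\<lambda>i. n - i) ` M"
      by cases (use hn that in \<open>auto simp: doubleton_eq_iff\<close>)
  next
    fix w assume "w \<in> (\<lambda>i. i + 1) ` M \<union> (\<lambda>i. n - i) ` M"
    then show "w \<in> {w. {h + 1, w} \<in> F}"
      unfolding F_def by auto
  qed
  have bij: "card {i. i < h \<and> g i < k} = k" if "inj_on g {..<h}" "g ` {..<h} \<subseteq> {..<h}" for g :: "nat \<Rightarrow> nat"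
  proof -
    have "g ` {..<h} = {..<h}"
      using that by (simp add: endo_inj_surj)
    then have "g ` {i. i < h \<and> g i < k} = {..<k}"
    proof (intro Set.set_eqI iffI)
      fix t assume "t \<in> {..<k}"
      then have "t \<in> {..<h}" using kh by auto
      then obtain i where "i < h" "t = g i"
        using \<open>g ` {..<h} = {..<h}\<close> by blast
      then show "t \<in> g ` {i. i < h \<and> g i < k}"
        using \<open>t \<in> {..<k}\<close> by auto
    qed auto
    moreover have "inj_on g {i. i < h \<and> g i < k}"
      using that(1) by (rule inj_on_subset) auto
    ultimately show ?thesis
      by (metis card_image card_lessThan)
  qed
  have degb: "card {w. {n - j, w} \<in> F} = k" if j: "j < h" for j
  proof -
    let ?A = "{i. i < h \<and> d i j < k}"
    have A: "card ?A = k" "finite ?A"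
      using j by (intro bij) (auto simp: d_def inj_on_def split: if_splits)
    have eq: "{w. {n - j, w} \<in> F} = (\<lambda>i. i + 1) ` (?A - (if j \<in> M then {j} else {})) \<union> (if j \<in> M then {h + 1} else {})"
      unfolding nb[OF j] by auto
    have "j \<in> ?A"
      using j k by (simp add: d_def)
    then show ?thesis
      unfolding eq using A k by (auto simp: card_image card_insert_if image_iff)
  qed
  have dega: "card {w. {i + 1, w} \<in> F} = k" if i: "i < h" for i
  proof -
    let ?A = "{j. j < h \<and> d i j < k}"
    have A: "card ?A = k" "finite ?A"
      using i by (intro bij) (auto simp: d_def inj_on_def split: if_splits)
    have eq: "{w. {i + 1, w} \<in> F} = (\<lambda>j. n - j) ` (?A - (if i \<in> M then {i} else {})) \<union> (if i \<in> M then {h + 1} else {})"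
      unfolding na[OF i] by auto
    have "i \<in> ?A"
      using i k by (simp add: d_def)
    moreover have "inj_on (\<lambda>j. n - j) B" if "B \<subseteq> ?A" for B
    proof (rule inj_onI)
      fix a b assume "a \<in> B" "b \<in> B" "n - a = n - b"
      moreover from this have "a < h" "b < h" using that by auto
      ultimately show "a = b" using nh by linarith
    qed
    moreover have "h + 1 \<notin> (\<lambda>j. n - j) ` (?A - {i})" if "i \<in> M"
      using M[OF that] by auto
    ultimately show ?thesis
      unfolding eq using A k by (auto simp: card_image card_insert_if)
  qed
  have degc: "card {w. {h + 1, w} \<in> F} = k" if "odd n"
  proof -
    have "inj_on (\<lambda>i. n - i) M"
    proof (rule inj_onI)
      fix a b assume "a \<in> M" "b \<in> M" "n - a = n - b"
      then show "a = b" using M(3)[of a] M(3)[of b] nh by linarith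
    qed
    moreover have "(\<lambda>i. i + 1) ` M \<inter> (\<lambda>i. n - i) ` M = {}"
    proof -
      have "i + 1 \<noteq> n - j" if "i \<in> M" "j \<in> M" for i j
        using M(3)[OF that(1)] M(3)[OF that(2)] M(5)[OF that(1)] by linarith
      then show ?thesis by blast
    qed
    ultimately show ?thesis
      unfolding nc[OF that] using finM cardM[OF that] by (simp add: card_Un_disjoint card_image)
  qed
  have vcases: "(\<exists>i<h. v = i + 1) \<or> (\<exists>j<h. v = n - j) \<or> (odd n \<and> v = h + 1)" if "v \<in> {1..n}" for v
  proof (cases "v \<le> h")
    case True
    then have "v - 1 < h" "v = (v - 1) + 1" using that by auto
    then show ?thesis by blast
  next
    case False
    show ?thesis
    proof (cases "odd n \<and> v = h + 1")
      case False
      then have "n = 2 * h \<or> n = 2 * h + 1 \<and> v \<noteq> h + 1"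
        using hn by blast
      then have "n - v < h" "v = n - (n - v)"
        using that \<open>\<not> v \<le> h\<close> by auto
      then show ?thesis by blast
    qed simp
  qed
  have FP: "F \<subseteq> pairs {1..n}"
    unfolding F_def using nh h2 M by (auto simp: pair_in_pairs simp del: One_nat_def) (fastforce+)?
  have "regular_edges k {1..n} F"
    unfolding regular_edges_def card_star[OF FP] using FP vcases dega degb degc by blast
  moreover have "{w. {n, w} \<in> F} = {1..k}"
  proof -
    have "{w. {n, w} \<in> F} = {w. \<exists>i<h. w = i + 1 \<and> i < k}"
    proof (rule Collect_cong)
      fix w
      have "0 \<notin> M" using M(4)[of 0] by auto
      then show "{n, w} \<in> F \<longleftrightarrow> (\<exists>i<h. w = i + 1 \<and> i < k)"
        using nb[of 0 w] h2 by (auto simp: d_def)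
    qed
    also have "\<dots> = {1..k}"
    proof (intro Set.set_eqI iffI)
      fix w assume "w \<in> {1..k}"
      then have "w - 1 < h" "w = (w - 1) + 1" "w - 1 < k"
        using kh by auto
      then show "w \<in> {w. \<exists>i<h. w = i + 1 \<and> i < k}"
        by blast
    qed auto
    finally show ?thesis .
  qed
  moreover have "{w. {n - 1, w} \<in> F} = {2..k+1}"
  proof -
    have "{w. {n - 1, w} \<in> F} = {w. \<exists>i<h. w = i + 1 \<and> d i 1 < k}"
      using nb[of 1] h2 M(4) by fastforce
    \<comment> \<open>The wrapped value \<open>d 0 1 = h - 1\<close> is at least \<open>k\<close>
      because \<open>k + 1 \<le> h\<close>, so vertex 1 is no neighbour of
      \<open>n - 1\<close>.\<close>
    also have "\<dots> = {2..k+1}"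
    proof (intro Set.set_eqI iffI)
      fix w assume "w \<in> {w. \<exists>i<h. w = i + 1 \<and> d i 1 < k}"
      then show "w \<in> {2..k+1}"
        using kh by (auto simp: d_def split: if_splits)
    next
      fix w assume "w \<in> {2..k+1}"
      then have "w - 1 < h" "w = (w - 1) + 1" "d (w - 1) 1 < k"
        using kh by (auto simp: d_def)
      then show "w \<in> {w. \<exists>i<h. w = i + 1 \<and> d i 1 < k}"
        by blast
    qed
    finally show ?thesis .
  qed
  \<comment> \<open>Apart from the edges at \<open>n\<close>, these are the positions that
    \<open>shifted_heavy_low_edges\<close> can guarantee. In the third case \<open>i\<close> is the
    middle vertex \<open>h + 1\<close>, whose larger neighbours are \<open>n - i'\<close> with
    \<open>i' \<ge> 2\<close>.\<close>
  moreover have "j = n \<and> i \<le> k \<or> i \<le> n div 2 \<and> j \<le> n - 1 \<or> 2 * i = n + 1 \<and> j \<le> n - 2"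
    if ij: "{i, j} \<in> F" "i < j" for i j
  proof -
    have "i \<in> {1..n}" "j \<in> {1..n}"
      using FP ij by auto
    from vcases[OF this(1)] consider (a) i' where "i' < h" "i = i' + 1" | (b) j' where "j' < h" "i = n - j'" | (c) "odd n" "i = h + 1"
      by blast
    then show ?thesis
    proof cases
      case (a i')
      then have "{i' + 1, j} \<in> F" using ij by simp
      then consider j' where "j' < h" "j = n - j'" "d i' j' < k" | "j = h + 1" "i' \<in> M"
        using na[OF a(1)] by blast
      then show ?thesis
      proof cases
        case (1 j')
        show ?thesis
        proof (cases "j' = 0")
          case True
          then have "j = n" "i \<le> k"
            using a 1 by (auto simp: d_def)
          then show ?thesis by blast
        next
          case False
          then have "i \<le> h" "j \<le> n - 1"
            using a 1 by auto
          then show ?thesis by (simp add: h_def)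
        qed
      next
        case 2
        then have "i \<le> h" "j \<le> n - 1"
          using a h2 M(5)[OF 2(2)] by auto
        then show ?thesis by (simp add: h_def)
      qed
    next
      case (b j')
      then have "{n - j', j} \<in> F" using ij by simp
      then have "j \<le> h \<or> j = h + 1 \<and> j' \<in> M"
        using nb[OF b(1)] by auto
      then have False
      proof
        assume "j \<le> h"
        then show False using b ij(2) nh by linarith
      next
        assume "j = h + 1 \<and> j' \<in> M"
        then show False using b ij(2) M(5)[of j'] by linarith
      qed
      then show ?thesis ..
    next
      case c
      then have "j \<in> (\<lambda>i. i + 1) ` M \<union> (\<lambda>i. n - i) ` M"
        using nc ij by blast
      then obtain i' where i': "i' \<in> M" "j = i' + 1 \<or> j = n - i'"
        by blast
      then have "j = n - i'"
        using c(2) ij(2) M(3)[OF i'(1)] by linarith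
      then have "2 * i = n + 1" "j \<le> n - 2"
        using c(2) M(4,5)[OF i'(1)] by auto
      then show ?thesis by blast
    qed
  qed
  ultimately show ?thesis
    by (rule that)
qed

section \<open>Factors with two prescribed stars\<close>

text \<open>In the low factor \<open>n\<close> and \<open>n - 1\<close> are not adjacent, share the
  neighbours \<open>{2..k}\<close> and have one private neighbour each, \<open>1\<close> and
  \<open>k + 1\<close>. Relabelling these \<open>k + 3\<close> vertices moves them to any prescribed
  position.\<close>

lemma exists_factor_two_stars:
  assumes V: "finite V" and k: "k \<ge> 1" and n: "card V \<ge> 4 * k - 1" "even (k * card V)"
    and xy: "x \<in> V" "y \<in> V" "x \<noteq> y" and N: "N \<subseteq> V - {x, y}" "card N = k - 1"
    and z: "z \<in> V - N - {x, y}" "z' \<in> V - N - {x, y}" "z \<noteq> z'"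
  obtains F where "regular_edges k V F" "{w. {x, w} \<in> F} = insert z N" "{w. {y, w} \<in> F} = insert z' N"
proof -
  define n where "n = card V"
  obtain F where F: "regular_edges k {1..n} F" "{w. {n, w} \<in> F} = {1..k}" "{w. {n - 1, w} \<in> F} = {2..k+1}"
    using exists_low_factor[OF k n] unfolding n_def by metis
  have finN: "finite N"
    using V N finite_subset by blast
  \<comment> \<open>The \<open>k + 3\<close> prescribed vertices are distinct, so
    \<open>n - 1\<close> exceeds \<open>k + 1\<close> and the labels collected in \<open>S\<close>
    do not collide.\<close>
  have "card (insert x (insert y (insert z (insert z' N)))) \<le> n"
    unfolding n_def using V xy N z by (intro card_mono) auto
  moreover have "card (insert x (insert y (insert z (insert z' N)))) = k + 3"
    using finN xy N z k by (subst card_insert_disjoint, simp, blast)+ simp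
  ultimately have nk: "k + 3 \<le> n" by simp
  obtain q where q: "bij_betw q {2..k} N"
    using finite_same_card_bij[of "{2..k}" N] finN N(2) by auto
  have qN: "q i \<in> N" if "2 \<le> i" "i \<le> k" for i
    using q that by (auto simp: bij_betw_def)
  have qinj: "q i = q j \<Longrightarrow> i = j" if "2 \<le> i" "i \<le> k" "2 \<le> j" "j \<le> k" for i j
    using q that by (auto simp: bij_betw_def inj_on_def)
  define g where "g i = (if i = n then x else if i = n - 1 then y else if i = 1 then z else if i = k + 1 then z' else q i)" for i
  have gv: "g n = x" "g (n - 1) = y" "g 1 = z" "g (k + 1) = z'"
    using nk k by (auto simp: g_def)
  have gq: "g i = q i" if "i \<in> {2..k}" for i
    using that nk by (auto simp: g_def)
  have gN: "g ` {2..k} = N"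
    using q gq by (simp add: bij_betw_def)
  define S where "S = insert n (insert (n - 1) (insert 1 (insert (k + 1) {2..k})))"
  have ins: "inj_on g (insert a A)" if "inj_on g A" "g a \<notin> g ` A" for a A
    using that by auto
  have "inj_on g {2..k}"
    using q gq by (auto simp: bij_betw_def inj_on_def)
  then have "inj_on g S"
    unfolding S_def by (intro ins) (use gv gN xy N z in auto)
  moreover have "g ` S \<subseteq> V"
    unfolding S_def image_insert gv gN using xy N z by auto
  moreover have "S \<subseteq> {1..n}"
    using nk by (auto simp: S_def)
  moreover have "card {1..n} = card V"
    by (simp add: n_def)
  ultimately obtain p where p: "bij_betw p {1..n} V" "\<And>s. s \<in> S \<Longrightarrow> p s = g s"
    using bij_betw_extend[OF finite_atLeastAtMost V] by metis
  note im = regular_edges_image[OF p(1) F(1)]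
  have pg: "p n = x" "p (n - 1) = y" "p 1 = z" "p (k + 1) = z'" "\<And>i. i \<in> {2..k} \<Longrightarrow> p i = q i"
    using p(2) gv gq by (auto simp: S_def)
  have star: "{w. {p v, w} \<in> (`) p ` F} = p ` {w. {v, w} \<in> F}" if "v \<in> {1..n}" for v
  proof (intro Set.set_eqI iffI)
    fix w assume w: "w \<in> {w. {p v, w} \<in> (`) p ` F}"
    then have "{p v, w} \<in> pairs V"
      using im(1) unfolding regular_edges_def by blast
    then have "w \<in> V" by simp
    then obtain u where "u \<in> {1..n}" "w = p u"
      using p(1) by (auto simp: bij_betw_def)
    then show "w \<in> p ` {w. {v, w} \<in> F}"
      using w im(2)[OF that] by auto
  next
    fix w assume "w \<in> p ` {w. {v, w} \<in> F}"
    then obtain u where u: "{v, u} \<in> F" "w = p u" by blast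
    then have "{v, u} \<in> pairs {1..n}"
      using F(1) unfolding regular_edges_def by blast
    then have "u \<in> {1..n}" by simp
    then show "w \<in> {w. {p v, w} \<in> (`) p ` F}"
      using u im(2)[OF that] by auto
  qed
  have pN: "p ` {2..k} = N"
    using q pg(5) by (simp add: bij_betw_def)
  have "{1..k} = insert 1 {2..k}" "{2..k+1} = insert (k + 1) {2..k}"
    using k by auto
  then have "p ` {1..k} = insert z N" "p ` {2..k+1} = insert z' N"
    using pN pg by auto
  then have "{w. {x, w} \<in> (`) p ` F} = insert z N" "{w. {y, w} \<in> (`) p ` F} = insert z' N"
    using star[of n] star[of "n - 1"] F nk pg by auto
  then show ?thesis
    using that im(1) by blast
qed

text \<open>All graphs are complete off \<open>x\<close> and \<open>y\<close> and join both to
  \<open>N\<close>. Only the private edges \<open>{x, z}\<close> and \<open>{y, z'}\<close> depend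
  on the graph, and the distinct indices \<open>i\<close> and \<open>i'\<close> provide
  them.\<close>

lemma rainbow_two_stars:
  assumes V: "finite V" "finite I" "2 * card I = k * card V" and k: "k \<ge> 1" and n: "card V \<ge> 4 * k - 1"
    and xy: "x \<in> V" "y \<in> V" "x \<noteq> y" and N: "N \<subseteq> V - {x, y}" "card N = k - 1"
    and z: "z \<in> V - N - {x, y}" "z' \<in> V - N - {x, y}" "z \<noteq> z'"
    and i: "i \<in> I" "i' \<in> I" "i \<noteq> i'" "{x, z} \<in> E i" "{y, z'} \<in> E i'"
    and E: "\<And>j e. j \<in> I \<Longrightarrow> e \<in> pairs V \<Longrightarrow> x \<notin> e \<Longrightarrow> y \<notin> e \<Longrightarrow> e \<in> E j"
      "\<And>j v. j \<in> I \<Longrightarrow> v \<in> N \<Longrightarrow> {x, v} \<in> E j" "\<And>j v. j \<in> I \<Longrightarrow> v \<in> N \<Longrightarrow> {y, v} \<in> E j"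
  shows "rainbow k V I E"
proof -
  have "even (k * card V)"
    using V(3) by (metis dvd_triv_left)
  then obtain F where F: "regular_edges k V F" "{w. {x, w} \<in> F} = insert z N" "{w. {y, w} \<in> F} = insert z' N"
    using exists_factor_two_stars[OF V(1) k n _ xy N z] by metis
  show ?thesis
  proof (rule rainbow_two_special[OF V F(1)])
    show "{x, z} \<in> F" "{y, z'} \<in> F"
      using F by auto
    show "{x, z} \<noteq> {y, z'}"
      using xy z by (auto simp: doubleton_eq_iff)
    fix d j assume d: "d \<in> F" "d \<noteq> {x, z}" "d \<noteq> {y, z'}" "j \<in> I"
    then have dp: "d \<in> pairs V"
      using F(1) by (auto simp: regular_edges_def)
    show "d \<in> E j"
    proof (cases "x \<in> d")
      case True
      then obtain w where w: "d = {x, w}"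
        using dp by (auto elim: pairsE)
      then have "w \<in> insert z N" using F d by blast
      then show ?thesis using d w E by auto
    next
      case False
      show ?thesis
      proof (cases "y \<in> d")
        case True
        then obtain w where w: "d = {y, w}"
          using dp by (auto elim: pairsE)
        then have "w \<in> insert z' N" using F d by blast
        then show ?thesis using d w E by auto
      qed (use False d dp E in auto)
    qed
  qed (use i in auto)
qed

section \<open>Almost complete graphs and shifted families\<close>

text \<open>For \<open>card N = k - 1\<close> a labelled copy of H_{n,k}: \<open>w\<close> is the
  single vertex \<open>K_1\<close> and \<open>N\<close> the clique \<open>K_{k-1}\<close> joined to
  everything, see \<open>almost_clique_iso_H_graph\<close>.\<close>

definition almost_clique :: "'a set \<Rightarrow> 'a \<Rightarrow> 'a set \<Rightarrow> 'a set set" where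
  "almost_clique V w N = {e \<in> pairs V. w \<notin> e} \<union> (\<lambda>v. {w, v}) ` N"

lemma almost_clique_pairs: "w \<in> V \<Longrightarrow> N \<subseteq> V - {w} \<Longrightarrow> almost_clique V w N \<subseteq> pairs V"
  by (auto simp: almost_clique_def)

lemma almost_clique_off: "w \<notin> e \<Longrightarrow> e \<in> almost_clique V w N \<longleftrightarrow> e \<in> pairs V"
  by (auto simp: almost_clique_def)

lemma almost_clique_star: "w \<notin> N \<Longrightarrow> {w, v} \<in> almost_clique V w N \<longleftrightarrow> v \<in> N"
  by (auto simp: almost_clique_def doubleton_eq_iff)

lemma almost_clique_eqI:
  assumes "E \<subseteq> pairs V" "N \<subseteq> V - {w}"
    and off: "\<And>e. e \<in> pairs V \<Longrightarrow> w \<notin> e \<Longrightarrow> e \<in> E"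
    and star: "\<And>v. v \<in> V \<Longrightarrow> v \<noteq> w \<Longrightarrow> {w, v} \<in> E \<longleftrightarrow> v \<in> N"
  shows "E = almost_clique V w N"
proof (intro Set.set_eqI iffI)
  fix e assume e: "e \<in> E"
  show "e \<in> almost_clique V w N"
  proof (cases "w \<in> e")
    case True
    with e assms(1) obtain v where "e = {w, v}" "v \<in> V" "v \<noteq> w"
      by (metis pairsE subsetD)
    with star e show ?thesis by (auto simp: almost_clique_def)
  qed (use e assms(1) in \<open>auto simp: almost_clique_def\<close>)
next
  fix e assume "e \<in> almost_clique V w N"
  then show "e \<in> E"
    using assms by (auto simp: almost_clique_def)
qed

lemma card_pairs: "finite V \<Longrightarrow> card (pairs V) = card V choose 2"
  unfolding pairs_def by (rule n_subsets)

lemma heavy_mono: "heavy V r E \<Longrightarrow> s \<le> r \<Longrightarrow> heavy V s E"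
  unfolding heavy_def by (meson mult_right_mono order_trans sum_nonneg zero_le_power2)

text \<open>A test vector \<open>u\<close> for a proper subgraph attains the maximum for the full
  graph \<open>C\<close>, so it is an eigenvector of \<open>C\<close> and has product 0 on a missing
  edge. As \<open>u\<close> is nonnegative, a zero spreads to all neighbours in \<open>C\<close>.
  Vertices other than \<open>w\<close> are pairwise adjacent, hence all zero, and then the row of
  \<open>w\<close> forces \<open>r * u w = 0\<close>. This also covers empty \<open>N\<close>, where
  \<open>C\<close> is disconnected.\<close>

lemma heavy_subset_almost_clique:
  assumes V: "finite V" and w: "w \<in> V" "N \<subseteq> V - {w}" and E: "E \<subseteq> almost_clique V w N"
    and r: "r > 0" and hv: "heavy V r E"
    and top: "\<And>x. 2 * quad (almost_clique V w N) x \<le> r * (\<Sum>v\<in>V. (x v)\<^sup>2)"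
  shows "E = almost_clique V w N"
proof (rule ccontr)
  define C where "C = almost_clique V w N"
  assume "E \<noteq> almost_clique V w N"
  then obtain e where e: "e \<in> C" "e \<notin> E"
    using E by (auto simp: C_def)
  obtain u where u: "\<And>v. 0 \<le> u v" "\<exists>v\<in>V. u v \<noteq> 0" "r * (\<Sum>v\<in>V. (u v)\<^sup>2) \<le> 2 * quad E u"
    using hv by (auto simp: heavy_def)
  have Cp: "C \<subseteq> pairs V" and EC: "E \<subseteq> C"
    using almost_clique_pairs[OF w] E by (auto simp: C_def)
  have finC: "finite C"
    using finite_subset[OF Cp finite_pairs[OF V]] .
  have nn: "0 \<le> (\<Prod>v\<in>d. u v)" for d
    using u(1) by (simp add: prod_nonneg)
  have split: "quad C u = quad (C - E) u + quad E u"
    unfolding quad_def using finC EC by (rule sum.subset_diff[rotated])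
  moreover have "0 \<le> quad (C - E) u"
    unfolding quad_def using nn by (simp add: sum_nonneg)
  ultimately have zero: "quad (C - E) u = 0" and eqC: "2 * quad C u = r * (\<Sum>v\<in>V. (u v)\<^sup>2)"
    using top[of u] u(3) unfolding C_def[symmetric] by linarith+
  have eig: "(\<Sum>j\<in>V. of_bool ({v, j} \<in> C) * u j) = r * u v" if "v \<in> V" for v
    using rayleigh_eigen[of V "\<lambda>i j. of_bool ({i, j} \<in> C)" r u v] V that
    by (simp add: quad_double_sum[OF V Cp] top[folded C_def] eqC insert_commute)
  have nbr: "u j = 0" if "v \<in> V" "u v = 0" "j \<in> V" "{v, j} \<in> C" for v j
  proof -
    have "(\<Sum>j\<in>V. of_bool ({v, j} \<in> C) * u j) = 0"
      using eig that by simp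
    then have "of_bool ({v, j} \<in> C) * u j = 0"
      using V u(1) that(3) by (subst (asm) sum_nonneg_eq_0_iff) auto
    then show ?thesis using that by simp
  qed
  obtain a b where ab: "e = {a, b}" "a \<noteq> b" "a \<in> V" "b \<in> V"
    using e(1) Cp by (auto simp: pairs_def card_2_iff)
  have "(\<Prod>v\<in>e. u v) = 0"
    using zero e finC nn unfolding quad_def by (subst (asm) sum_nonneg_eq_0_iff) auto
  then have "u a = 0 \<or> u b = 0"
    using ab by simp
  then have "u a = 0" "u b = 0"
    using nbr[of a b] nbr[of b a] ab e by (auto simp: insert_commute)
  then obtain c where c: "c \<in> V" "c \<noteq> w" "u c = 0"
    using ab by blast
  have off: "u v = 0" if "v \<in> V" "v \<noteq> w" for v
    using nbr[of c v] c that by (cases "v = c") (auto simp: C_def almost_clique_off)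
  have "{w, w} \<notin> C"
    using Cp by (auto simp: pairs_def)
  then have "(\<Sum>j\<in>V. of_bool ({w, j} \<in> C) * u j) = 0"
  proof (intro sum.neutral ballI)
    fix j assume "j \<in> V"
    then show "of_bool ({w, j} \<in> C) * u j = 0"
      using off[of j] \<open>{w, w} \<notin> C\<close> by (cases "j = w") auto
  qed
  then have "u w = 0"
    using eig[OF w(1)] r by simp
  then show False
    using u(2) off by blast
qed

section \<open>Shifted graphs with few missing edges\<close>

lemma shifted_down:
  assumes "shift x y E = E" "{y, z} \<in> E" "x \<noteq> y" "z \<noteq> x" "z \<noteq> y"
  shows "{x, z} \<in> E"
  using assms shift_target[of x y z E] by simp

text \<open>The smaller endpoint is lowered before the larger one; in this order the two endpoints
  never meet on the way.\<close>

lemma shifted_pair_mono: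
  assumes sh: "\<And>x y. x \<in> {1..n} \<Longrightarrow> y \<in> {1..n} \<Longrightarrow> x < y \<Longrightarrow> shift x y E = E"
    and "{i', j'} \<in> E" "1 \<le> i" "i \<le> i'" "i' < j'" "i < j" "j \<le> j'" "j' \<le> (n::nat)"
  shows "{i, j} \<in> E"
proof -
  have "{i, j'} \<in> E"
  proof (cases "i = i'")
    case False
    then show ?thesis
      using assms(2-) by (intro shifted_down[OF sh[of i i']]) auto
  qed (use assms in simp)
  then have "{j', i} \<in> E"
    by (simp add: insert_commute)
  then have "{j, i} \<in> E"
  proof (cases "j = j'")
    case False
    then show ?thesis
      using \<open>{j', i} \<in> E\<close> assms(2-) by (intro shifted_down[OF sh[of j j']]) auto
  qed simp
  then show ?thesis
    by (simp add: insert_commute)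
qed

text \<open>If \<open>{i, j}\<close> is missing, so are all edges with both endpoints moved up. The
  columns \<open>n\<close> and \<open>n - 1\<close> above \<open>i\<close> alone contain
  \<open>2 * n - 1 - 2 * i\<close> such edges, more than \<open>n - 2\<close> once
  \<open>i \<le> n div 2\<close>. For \<open>2 * i = n + 1\<close> the column \<open>n - 2\<close>
  is added, and the total \<open>(3 * n - 9) / 2\<close> exceeds \<open>n - 2\<close> exactly from
  \<open>n = 7\<close> on. The edge \<open>{1, n}\<close> rules out isolated vertices, as Hong's
  bound requires.\<close>

lemma shifted_heavy_low_edges:
  fixes n :: nat
  assumes n: "4 \<le> n" and E: "E \<subseteq> pairs {1..n}" and hv: "heavy {1..n} (real (n - 2)) E"
    and sh: "\<And>x y. x \<in> {1..n} \<Longrightarrow> y \<in> {1..n} \<Longrightarrow> x < y \<Longrightarrow> shift x y E = E"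
    and "{1, n} \<in> E" and ij: "1 \<le> i" "i < j"
    and low: "i \<le> n div 2 \<and> j \<le> n - 1 \<or> 2 * i = n + 1 \<and> j \<le> n - 2 \<and> 7 \<le> n"
  shows "{i, j} \<in> E"
proof (rule ccontr)
  assume notin: "{i, j} \<notin> E"
  have mono: "{a, b} \<in> E" if "{i', j'} \<in> E" "1 \<le> a" "a \<le> i'" "i' < j'" "a < b" "b \<le> j'" "j' \<le> n" for a b i' j'
    by (rule shifted_pair_mono[OF sh that])
  have "\<exists>w. {v, w} \<in> E" if "v \<in> {1..n}" for v
  proof (cases "v = 1")
    case False
    then have "{1, v} \<in> E"
      using that n \<open>{1, n} \<in> E\<close> mono[of 1 n 1 v] by auto
    then show ?thesis
      by (metis insert_commute)
  qed (use \<open>{1, n} \<in> E\<close> in auto)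
  then have "(real (n - 2))\<^sup>2 + real n - 1 \<le> 2 * real (card E)"
    using heavy_imp_many_edges[OF _ E _ hv] by simp
  then have "real ((n - 2)\<^sup>2 + n) \<le> real (2 * card E + 1)"
    by simp
  then have edges: "(n - 2)\<^sup>2 + n \<le> 2 * card E + 1"
    using of_nat_le_iff by blast
  have up: "{a, b} \<in> pairs {1..n} - E" if "i \<le> a" "a < b" "j \<le> b" "b \<le> n" for a b
    using mono[of a b i j] that ij notin by auto
  define col where "col b = (\<lambda>a. {a, b}) ` {i..<b}" for b
  have col: "card (col b) = b - i" "finite (col b)" for b
    unfolding col_def by (subst card_image) (auto simp: inj_on_def doubleton_eq_iff)
  have disj: "col b \<inter> col b' = {}" if "b \<noteq> b'" for b b'
    using that by (auto simp: col_def doubleton_eq_iff)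
  have sub: "col b \<subseteq> pairs {1..n} - E" if "j \<le> b" "b \<le> n" for b
    using that up unfolding col_def by (intro image_subsetI) auto
  have finp: "finite (pairs {1..n})"
    by (simp add: finite_pairs)
  have "even (n * (n - 1))"
    using n by auto
  then have "2 * card (pairs {1..n}) = n * (n - 1)"
    by (simp add: card_pairs choose_two)
  moreover have "card (pairs {1..n} - E) = card (pairs {1..n}) - card E"
    using E finp by (meson card_Diff_subset finite_subset)
  \<comment> \<open>The right side minus the square and \<open>n\<close> is
    \<open>2 * n - 3\<close>; being odd, it leaves at most \<open>n - 2\<close> missing
    edges.\<close>
  ultimately have "2 * card (pairs {1..n} - E) + ((n - 2)\<^sup>2 + n) \<le> n * (n - 1) + 1"
    using edges card_mono[OF finp E] by simp
  moreover obtain m where "n = m + 2"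
    using n by (metis add.commute le_Suc_ex numeral_Bit0 add_leD1)
  ultimately have miss: "card (pairs {1..n} - E) \<le> n - 2"
    by (auto simp: power2_eq_square algebra_simps)
  from low show False
  proof
    assume *: "i \<le> n div 2 \<and> j \<le> n - 1"
    have "card (col n \<union> col (n - 1)) = (n - i) + (n - 1 - i)"
      using col disj n by (subst card_Un_disjoint) auto
    moreover have "card (col n \<union> col (n - 1)) \<le> card (pairs {1..n} - E)"
      using * finp by (intro card_mono Un_least sub) auto
    ultimately show False
      using miss * n ij by linarith
  next
    assume *: "2 * i = n + 1 \<and> j \<le> n - 2 \<and> 7 \<le> n"
    have "card (col n \<union> col (n - 1)) = (n - i) + (n - 1 - i)"
      using col disj n by (subst card_Un_disjoint) auto
    moreover have "(col n \<union> col (n - 1)) \<inter> col (n - 2) = {}"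
      using disj[of n "n - 2"] disj[of "n - 1" "n - 2"] n by (auto simp: Int_Un_distrib2)
    ultimately have "card (col n \<union> col (n - 1) \<union> col (n - 2)) = (n - i) + (n - 1 - i) + (n - 2 - i)"
      using col by (subst card_Un_disjoint) auto
    moreover have "card (col n \<union> col (n - 1) \<union> col (n - 2)) \<le> card (pairs {1..n} - E)"
      using * finp by (intro card_mono Un_least sub) auto
    ultimately show False
      using miss * n ij by linarith
  qed
qed

lemma rainbow_if_all_shifted:
  fixes n k :: nat
  assumes k: "k \<ge> 1" and n: "n \<ge> 4 * k - 1" and I: "finite I" "2 * card I = k * n"
    and E: "\<And>i. i \<in> I \<Longrightarrow> E i \<subseteq> pairs {1..n}" and hv: "\<And>i. i \<in> I \<Longrightarrow> heavy {1..n} r (E i)"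
    and r: "real (n - 2) \<le> r"
    and top: "\<And>x. 2 * quad (almost_clique {1..n} n {1..k - 1}) x \<le> r * (\<Sum>v=1..n. (x v)\<^sup>2)"
    and sh: "\<And>i x y. i \<in> I \<Longrightarrow> x \<in> {1..n} \<Longrightarrow> y \<in> {1..n} \<Longrightarrow> x < y \<Longrightarrow> shift x y (E i) = E i"
    and ne: "\<exists>i\<in>I. E i \<noteq> almost_clique {1..n} n {1..k - 1}"
  shows "rainbow k {1..n} I E"
proof -
  let ?C = "almost_clique {1..n} n {1..k - 1}"
  have kn: "even (k * n)"
    using I(2) by (metis dvd_triv_left)
  have n4: "4 \<le> n" "k < n"
  proof -
    show "4 \<le> n"
    proof (cases "k = 1")
      case True
      then have "even n" "3 \<le> n" using n kn by auto
      then show ?thesis by presburger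
    qed (use k n in auto)
    then show "k < n" using n by auto
  qed
  have edge_kn: "{k, n} \<in> E i" if i: "i \<in> I" "E i \<noteq> ?C" for i
  proof (rule ccontr)
    assume no: "{k, n} \<notin> E i"
    have "E i \<subseteq> ?C"
    proof
      fix e assume e: "e \<in> E i"
      then have ep: "e \<in> pairs {1..n}" using E i by blast
      show "e \<in> ?C"
      proof (cases "n \<in> e")
        case True
        then obtain v where v: "e = {n, v}" "v \<in> {1..n}" "v \<noteq> n"
          using ep by (auto elim: pairsE)
        have "v < k"
        proof (rule ccontr)
          assume "\<not> v < k"
          moreover have "{v, n} \<in> E i"
            using e v by (simp add: insert_commute)
          ultimately have "{k, n} \<in> E i"
            using shifted_pair_mono[OF sh[OF i(1)], where n = n and i' = v and j' = n and i = k and j = n] v k n4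
            by auto
          then show False using no by simp
        qed
        then show ?thesis using v by (auto simp: almost_clique_def)
      qed (use ep in \<open>simp add: almost_clique_off\<close>)
    qed
    then have "E i = ?C"
      using n4 r hv[OF i(1)] top by (intro heavy_subset_almost_clique[where r = r]) auto
    then show False using i by simp
  qed
  obtain j where j: "j \<in> I" "E j \<noteq> ?C"
    using ne by blast
  \<comment> \<open>The colouring fixes the colours of two edges, so a second index besides
    \<open>j\<close> must exist.\<close>
  have "2 * 2 \<le> 2 * card I"
    using I(2) k n4 mult_le_mono[of 1 k 4 n] by simp
  then have "\<exists>j'. j' \<in> I - {j}"
    using j I by (metis all_not_in_conv card_Diff_singleton card.empty diff_is_0_eq mult_le_cancel1 not_less_eq_eq numeral_2_eq_2 zero_less_numeral le_zero_eq One_nat_def)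
  then obtain j' where j': "j' \<in> I" "j' \<noteq> j" by blast
  obtain F where F: "regular_edges k {1..n} F" "{w. {n, w} \<in> F} = {1..k}" "{w. {n - 1, w} \<in> F} = {2..k+1}"
    "\<And>i j. {i, j} \<in> F \<Longrightarrow> i < j \<Longrightarrow>
      j = n \<and> i \<le> k \<or> i \<le> n div 2 \<and> j \<le> n - 1 \<or> 2 * i = n + 1 \<and> j \<le> n - 2"
    using exists_low_factor[OF k n kn] by metis
  have in_all: "e \<in> E i" if e: "e \<in> F" "e \<noteq> {k, n}" and i: "i \<in> I" for e i
  proof -
    have "e \<in> pairs {1..n}"
      using F(1) e by (auto simp: regular_edges_def)
    then obtain a b where ab: "e = {a, b}" "a < b" "1 \<le> a" "b \<le> n"
      by (auto simp: pairs_def card_2_iff) (metis insert_commute linorder_neqE_nat)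
    show ?thesis
    proof (cases "E i = ?C")
      case True
      have "e \<in> ?C"
      proof (cases "b = n")
        case True
        then have "a \<in> {1..k}"
          using F(2) ab e by (auto simp: insert_commute)
        then have "a \<in> {1..k - 1}"
          using ab e True by auto
        then show ?thesis
          using ab True by (auto simp: almost_clique_def)
      next
        case False
        then show ?thesis
          using ab by (simp add: almost_clique_off)
      qed
      then show ?thesis using True by simp
    next
      case False
      have mono: "{i', j'} \<in> E i \<Longrightarrow> 1 \<le> a \<Longrightarrow> a \<le> i' \<Longrightarrow> i' < j' \<Longrightarrow> a < b \<Longrightarrow> b \<le> j' \<Longrightarrow> j' \<le> n \<Longrightarrow> {a, b} \<in> E i"
        for a b i' j'
        by (rule shifted_pair_mono[OF sh[OF i]])
      have kn': "{k, n} \<in> E i"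
        using edge_kn[OF i False] .
      then have "{1, n} \<in> E i"
        using kn' k n4 mono[where i' = k and j' = n and a = 1 and b = n] by auto
      have "{a, b} \<in> F"
        using e ab by simp
      then show ?thesis
        using F(4)[OF _ ab(2)]
      proof (elim disjE meta_impE)
        assume "b = n \<and> a \<le> k"
        then show ?thesis
          using kn' ab n4 mono[where i' = k and j' = n and a = a and b = b] by auto
      next
        assume *: "2 * a = n + 1 \<and> b \<le> n - 2"
        \<comment> \<open>A middle vertex exists only for odd \<open>n\<close>; then
          \<open>k\<close> is even, so \<open>k \<ge> 2\<close> and
          \<open>4 * k - 1 \<ge> 7\<close>.\<close>
        have "7 \<le> n"
        proof -
          have "odd n" using * by presburger
          then have "even k" using kn by simp
          then have "2 \<le> k" using k by (cases "k = 1") auto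
          then show ?thesis using n by simp
        qed
        then show ?thesis
          using shifted_heavy_low_edges[OF n4(1) E[OF i] heavy_mono[OF hv[OF i] r] sh[OF i] \<open>{1, n} \<in> E i\<close> ab(3,2)] * ab
          by simp
      qed (use shifted_heavy_low_edges[OF n4(1) E[OF i] heavy_mono[OF hv[OF i] r] sh[OF i] \<open>{1, n} \<in> E i\<close> ab(3,2)] ab in auto)
    qed
  qed
  show ?thesis
  \<comment> \<open>Only \<open>{k, n}\<close> is critical and gets the colour \<open>j\<close>. The
    edge \<open>{n - 1, 2}\<close> lies in every graph and just fills the second slot.\<close>
  proof (rule rainbow_two_special[where e = "{k, n}" and e' = "{n - 1, 2}" and i = j and i' = j'])
    show "{k, n} \<in> F" "{n - 1, 2} \<in> F"
      using F(2,3) k by (auto simp: insert_commute)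
    show "{k, n} \<noteq> {n - 1, 2}"
      using n4 by (auto simp: doubleton_eq_iff)
    then show "{n - 1, 2} \<in> E j'"
      using in_all[of "{n - 1, 2}" j'] \<open>{n - 1, 2} \<in> F\<close> j' by auto
  qed (use F(1) I j j' edge_kn in_all in auto)
qed

section \<open>Reduction to shifted families\<close>

lemma card_exchange:
  assumes "finite N" "x \<in> N" "y \<notin> N"
  shows "card (insert y (N - {x})) = card N"
  using assms card.remove[of N x] by simp

text \<open>The one obstruction is a two-element \<open>Z\<close> with complementary singletons
  \<open>P i = {p}\<close> and \<open>P j = {q}\<close>, where every choice has
  \<open>z = z'\<close>. A third element \<open>t\<close> of \<open>Z\<close> removes it, whether or
  not \<open>t\<close> lies in \<open>P i\<close>.\<close>

lemma choose_two_indices: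
  assumes P: "\<And>i. i \<in> I \<Longrightarrow> P i \<subseteq> Z" and I: "2 \<le> card I" and Z: "2 \<le> card Z"
    and ne: "\<exists>i\<in>I. P i \<noteq> {}" "\<exists>i\<in>I. P i \<noteq> Z"
    and big: "3 \<le> card Z \<or> (\<forall>i\<in>I. P i = {} \<or> P i = Z)"
  obtains i j z z' where "i \<in> I" "j \<in> I" "i \<noteq> j" "z \<in> Z" "z' \<in> Z" "z \<noteq> z'" "z \<notin> P i" "z' \<in> P j"
proof (cases "\<forall>i\<in>I. P i = {} \<or> P i = Z")
  case True
  then obtain i j where "i \<in> I" "j \<in> I" "P i = {}" "P j = Z" "Z \<noteq> {}"
    using ne by blast
  moreover obtain z z' where "z \<in> Z" "z' \<in> Z" "z \<noteq> z'"
    using Z by (metis card_le_Suc0_iff_eq card.infinite not_less_eq_eq numeral_2_eq_2 zero_le)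
  ultimately show ?thesis
    using that[of i j z z'] by auto
next
  case False
  then obtain i where i: "i \<in> I" "P i \<noteq> {}" "P i \<noteq> Z" by blast
  have Z3: "3 \<le> card Z"
    using big False by blast
  have "finite I"
    using I card.infinite by fastforce
  then have "card (I - {i}) \<noteq> 0"
    using i I by simp
  then obtain j where j: "j \<in> I" "j \<noteq> i"
    by (metis all_not_in_conv card.empty DiffD1 DiffD2 insertI1)
  obtain p q where pq: "p \<in> P i" "p \<in> Z" "q \<in> Z" "q \<notin> P i"
    using i P by blast
  have "p \<noteq> q" using pq by auto
  consider "P j = {}" | "P j = Z" | "P j \<noteq> {}" "P j \<noteq> Z" by blast
  then show ?thesis
  proof cases
    case 1
    then show ?thesis using that[of j i q p] i j pq \<open>p \<noteq> q\<close> by auto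
  next
    case 2
    then show ?thesis using that[of i j q p] i j pq \<open>p \<noteq> q\<close> by auto
  next
    case 3
    then obtain p' q' where pq': "p' \<in> P j" "p' \<in> Z" "q' \<in> Z" "q' \<notin> P j"
      using j P by blast
    show ?thesis
    proof (cases "q = p' \<and> q' = p")
      case False
      then consider "q \<noteq> p'" | "q' \<noteq> p" by blast
      then show ?thesis
      proof cases
        case 1
        show ?thesis by (rule that[of i j q p']) (use 1 i j pq pq' in auto)
      next
        case 2
        show ?thesis by (rule that[of j i q' p]) (use 2 i j pq pq' in auto)
      qed
    next
      case True
      have "\<not> Z \<subseteq> {p, q}"
      proof
        assume "Z \<subseteq> {p, q}"
        then have "card Z \<le> card {p, q}"
          by (intro card_mono) auto
        then show False
          using Z3 \<open>p \<noteq> q\<close> by simp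
      qed
      then obtain t where t: "t \<in> Z" "t \<noteq> p" "t \<noteq> q"
        by blast
      show ?thesis
      proof (cases "t \<in> P i")
        case True
        then show ?thesis
          using that[of j i q' t] t i j pq' \<open>q = p' \<and> q' = p\<close> by auto
      next
        case False
        then show ?thesis
          using that[of i j t p'] t i j pq' \<open>q = p' \<and> q' = p\<close> by auto
      qed
    qed
  qed
qed

text \<open>The special vertex \<open>w\<close> is not involved in the shift, so every
  \<open>E i\<close> is complete off \<open>w\<close> and agrees with \<open>N\<close> at
  \<open>w\<close> except at \<open>x\<close> and \<open>y\<close>. Since the family is not
  extremal, \<open>x \<in> N\<close> and \<open>y \<notin> N\<close>, each graph has exactly one of
  \<open>{w, x}\<close> and \<open>{w, y}\<close>, and both alternatives occur. A factor using both
  edges can then be coloured.\<close>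

lemma rainbow_step_off:
  assumes V: "finite V" "finite I" "2 * card I = k * card V" and k: "k \<ge> 1" and n: "card V \<ge> 4 * k - 1"
    and n4: "4 \<le> card V" "k + 3 \<le> card V" and xy: "x \<in> V" "y \<in> V" "x \<noteq> y"
    and E: "\<And>i. i \<in> I \<Longrightarrow> E i \<subseteq> pairs V"
    and w: "w \<in> V" "N \<subseteq> V - {w}" "card N = k - 1" "w \<noteq> x" "w \<noteq> y"
    and S: "\<And>i. i \<in> I \<Longrightarrow> shift x y (E i) = almost_clique V w N"
    and ne: "\<And>w N. w \<in> V \<Longrightarrow> N \<subseteq> V - {w} \<Longrightarrow> card N = k - 1 \<Longrightarrow> \<exists>i\<in>I. E i \<noteq> almost_clique V w N"
  shows "rainbow k V I E"
proof -
  have wN: "w \<notin> N" using w by auto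
  have finN: "finite N" using w V finite_subset by blast
  have off: "e \<in> E i" if i: "i \<in> I" and e: "e \<in> pairs V" "w \<notin> e" for e i
  proof -
    have in_S: "d \<in> shift x y (E i)" if "d \<in> pairs V" "w \<notin> d" for d
      using S[OF i] that by (simp add: almost_clique_off)
    consider "e = {x, y}" | z where "e = {x, z}" "z \<noteq> x" "z \<noteq> y" | z where "e = {y, z}" "z \<noteq> x" "z \<noteq> y"
      | "x \<notin> e" "y \<notin> e"
      using e by (metis pairsE insert_commute)
    then show ?thesis
    proof cases
      case 1
      then show ?thesis using in_S[OF e] xy by (simp add: shift_both)
    next
      case (2 z)
      then have "{y, z} \<in> shift x y (E i)"
        using e xy w by (intro in_S) auto
      then show ?thesis using 2 xy by (simp add: shift_source)
    next
      case (3 z)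
      then show ?thesis using in_S[OF e] xy by (simp add: shift_source)
    next
      case 4
      then show ?thesis using in_S[OF e] xy by (simp add: shift_off)
    qed
  qed
  have star: "{w, v} \<in> E i \<longleftrightarrow> v \<in> N" if "i \<in> I" "v \<noteq> x" "v \<noteq> y" for i v
    using S[OF that(1)] shift_off[of x y "{w, v}" "E i"] that w xy almost_clique_star[OF wN, of v V] by auto
  have starx: "{w, x} \<in> E i \<or> {w, y} \<in> E i \<longleftrightarrow> x \<in> N" if "i \<in> I" for i
    using S[OF that] shift_target[of x y w "E i"] w xy almost_clique_star[OF wN, of x V]
    by (simp add: insert_commute)
  have stary: "{w, x} \<in> E i \<and> {w, y} \<in> E i \<longleftrightarrow> y \<in> N" if "i \<in> I" for i
    using S[OF that] shift_source[of x y w "E i"] w xy almost_clique_star[OF wN, of y V]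
    by (simp add: insert_commute)
  have eqI: "E i = almost_clique V w N'" if "i \<in> I" "N' \<subseteq> V - {w}" "{w, x} \<in> E i \<longleftrightarrow> x \<in> N'" "{w, y} \<in> E i \<longleftrightarrow> y \<in> N'"
      "\<And>v. v \<noteq> x \<Longrightarrow> v \<noteq> y \<Longrightarrow> v \<in> N \<longleftrightarrow> v \<in> N'" for i N'
  proof (rule almost_clique_eqI[OF E[OF that(1)] that(2)])
    show "{w, v} \<in> E i \<longleftrightarrow> v \<in> N'" for v
      using that(3,4) that(5)[of v] star[OF that(1), of v] by (cases "v = x \<or> v = y") auto
  qed (use off that(1) in auto)
  obtain i0 where i0: "i0 \<in> I" "E i0 \<noteq> almost_clique V w N"
    using ne[OF w(1-3)] by blast
  have yN: "y \<notin> N" and xN: "x \<in> N"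
    using i0 eqI[OF i0(1) w(2)] starx[OF i0(1)] stary[OF i0(1)] by auto
  \<comment> \<open>If no graph contained \<open>{w, x}\<close>, all of them would be the copy with
    \<open>y\<close> in place of \<open>x\<close> in \<open>N\<close>, which \<open>ne\<close>
    excludes.\<close>
  obtain i where i: "i \<in> I" "{w, x} \<in> E i"
  proof -
    let ?N = "insert y (N - {x})"
    have "card ?N = k - 1"
      by (simp only: card_exchange[OF finN xN yN] w(3))
    moreover have "?N \<subseteq> V - {w}"
      using w xy by auto
    ultimately obtain i where "i \<in> I" "E i \<noteq> almost_clique V w ?N"
      using ne[OF w(1)] by blast
    then have "{w, x} \<in> E i"
      using eqI[of i ?N] starx[of i] \<open>?N \<subseteq> V - {w}\<close> xN xy by auto
    then show ?thesis using that \<open>i \<in> I\<close> by blast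
  qed
  obtain j where j: "j \<in> I" "{w, y} \<in> E j" "{w, x} \<notin> E j"
    using i0 eqI[OF i0(1) w(2)] starx[OF i0(1)] xN yN stary[OF i0(1)] by blast
  have "\<exists>a b. a \<noteq> b \<and> a \<in> V - insert w (insert y N) \<and> b \<in> V - insert w (insert y N)"
  proof -
    have "card (insert w (insert y N)) = k + 1"
      using finN w wN yN k by simp
    then have "2 \<le> card (V - insert w (insert y N))"
      using n4(2) finN by (subst card_Diff_subset) (use w xy in auto)
    then show ?thesis
      by (metis card_le_Suc0_iff_eq card.infinite not_less_eq_eq numeral_2_eq_2 zero_le)
  qed
  then obtain a b where ab: "a \<noteq> b" "a \<in> V - insert w (insert y N)" "b \<in> V - insert w (insert y N)"
    by blast
  have "even (k * card V)"
    using V(3) by (metis dvd_triv_left)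
  \<comment> \<open>The star at \<open>w\<close> is \<open>N\<close> together with \<open>y\<close>
    and so contains both critical edges; \<open>a\<close> and \<open>b\<close> merely supply the
    second star.\<close>
  then obtain F where F: "regular_edges k V F" "{v. {w, v} \<in> F} = insert y N"
    by (rule exists_factor_two_stars[OF V(1) k n, of w a N y b]) (use w xy yN ab in auto)
  show ?thesis
  proof (rule rainbow_two_special[OF V F(1)])
    show "{w, x} \<in> F" "{w, y} \<in> F"
      using F xN by auto
    show "{w, x} \<noteq> {w, y}"
      using xy by (auto simp: doubleton_eq_iff)
    fix d l assume d: "d \<in> F" "d \<noteq> {w, x}" "d \<noteq> {w, y}" "l \<in> I"
    then have dp: "d \<in> pairs V"
      using F(1) by (auto simp: regular_edges_def)
    show "d \<in> E l"
    proof (cases "w \<in> d")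
      case True
      then obtain v where v: "d = {w, v}"
        using dp by (auto elim: pairsE)
      then have "v \<in> insert y N" using F d by blast
      then show ?thesis using d v star by auto
    qed (use off dp d in auto)
  qed (use i j in auto)
qed

text \<open>Now \<open>y\<close> is the vertex of low degree after the shift. Each
  \<open>z \<in> Z\<close> is joined to exactly one of \<open>x\<close> and \<open>y\<close> in
  every \<open>E i\<close>, and \<open>P i\<close> records those joined to \<open>y\<close>. If all
  \<open>P i\<close> are empty, or all equal \<open>Z\<close>, the family consists of equal copies
  with special vertex \<open>y\<close> or \<open>x\<close>; otherwise two graphs offer edges
  \<open>{x, z}\<close> and \<open>{y, z'}\<close> with \<open>z \<noteq> z'\<close>.\<close>

lemma rainbow_step_at:
  assumes V: "finite V" "finite I" "2 * card I = k * card V" and k: "k \<ge> 1" and n: "card V \<ge> 4 * k - 1"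
    and n4: "4 \<le> card V" "k + 3 \<le> card V" and xy: "x \<in> V" "y \<in> V" "x \<noteq> y"
    and E: "\<And>i. i \<in> I \<Longrightarrow> E i \<subseteq> pairs V" and hv: "\<And>i. i \<in> I \<Longrightarrow> heavy V (real (card V) - 2) (E i)"
    and N: "N \<subseteq> V - {y}" "card N = k - 1"
    and S: "\<And>i. i \<in> I \<Longrightarrow> shift x y (E i) = almost_clique V y N"
    and ne: "\<And>w N. w \<in> V \<Longrightarrow> N \<subseteq> V - {w} \<Longrightarrow> card N = k - 1 \<Longrightarrow> \<exists>i\<in>I. E i \<noteq> almost_clique V w N"
  shows "rainbow k V I E"
proof -
  have yN: "y \<notin> N" using N by auto
  have finN: "finite N" using N V finite_subset by blast
  define Z where "Z = V - N - {x, y}"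
  define P where "P i = {z \<in> Z. {y, z} \<in> E i}" for i
  have off: "e \<in> E i" if "i \<in> I" "e \<in> pairs V" "x \<notin> e" "y \<notin> e" for e i
    using S[OF that(1)] that xy shift_off[of x y e "E i"] by (simp add: almost_clique_off)
  have nbr: "{x, v} \<in> E i" "{y, v} \<in> E i" if "i \<in> I" "v \<in> N" "v \<noteq> x" for i v
    using S[OF that(1)] that xy yN shift_source[of x y v "E i"] almost_clique_star[OF yN, of v V] by auto
  have xyE: "{x, y} \<in> E i \<longleftrightarrow> x \<in> N" if "i \<in> I" for i
    using S[OF that] shift_both[OF xy(3), of "E i"] almost_clique_star[OF yN, of x V]
    by (simp add: insert_commute)
  have one: "{x, z} \<in> E i \<longleftrightarrow> {y, z} \<notin> E i" if "i \<in> I" "z \<in> Z" for i z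
    using S[OF that(1)] that(2) xy shift_source[of x y z "E i"] shift_target[of x y z "E i"]
      almost_clique_star[OF yN, of z V] almost_clique_off[of y "{x, z}" V N]
    by (auto simp: Z_def)
  have eq1: "E i = almost_clique V y N" if i: "i \<in> I" "P i = {}" for i
  proof (rule almost_clique_eqI[OF E[OF i(1)] N(1)])
    have Py: "{y, z} \<notin> E i" if "z \<in> Z" for z
      using i that by (auto simp: P_def)
    show "{y, v} \<in> E i \<longleftrightarrow> v \<in> N" if "v \<in> V" "v \<noteq> y" for v
      using that Py[of v] nbr[OF i(1), of v] xyE[OF i(1)] by (cases "v = x") (auto simp: Z_def insert_commute)
    fix e assume e: "e \<in> pairs V" "y \<notin> e"
    show "e \<in> E i"
    proof (cases "x \<in> e")
      case True
      then obtain v where v: "e = {x, v}" "v \<in> V" "v \<noteq> x" "v \<noteq> y"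
        using e by (metis pairsE insert_iff)
      then show ?thesis
        using Py[of v] one[OF i(1), of v] nbr[OF i(1), of v] by (auto simp: Z_def)
    qed (use off i e in auto)
  qed
  \<comment> \<open>The neighbourhood of \<open>x\<close> once \<open>x\<close> plays the role of
    \<open>y\<close>: an edge \<open>{x, y}\<close>, present when \<open>x \<in> N\<close>, now
    counts \<open>y\<close> as a neighbour.\<close>
  define N' where "N' = (if x \<in> N then insert y (N - {x}) else N)"
  have N': "N' \<subseteq> V - {x}" "card N' = k - 1"
    using N finN yN xy by (auto simp: N'_def card_exchange)
  have eq2: "E i = almost_clique V x N'" if i: "i \<in> I" "P i = Z" for i
  proof (rule almost_clique_eqI[OF E[OF i(1)] N'(1)])
    have Py: "{y, z} \<in> E i" if "z \<in> Z" for z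
      using i that by (auto simp: P_def)
    show "{x, v} \<in> E i \<longleftrightarrow> v \<in> N'" if "v \<in> V" "v \<noteq> x" for v
      using that Py[of v] one[OF i(1), of v] nbr[OF i(1), of v] xyE[OF i(1)] yN
      by (cases "v = y") (auto simp: Z_def N'_def)
    fix e assume e: "e \<in> pairs V" "x \<notin> e"
    show "e \<in> E i"
    proof (cases "y \<in> e")
      case True
      then obtain v where v: "e = {y, v}" "v \<in> V" "v \<noteq> x" "v \<noteq> y"
        using e by (metis pairsE insert_iff)
      then show ?thesis
        using Py[of v] nbr[OF i(1), of v] by (auto simp: Z_def)
    qed (use off i e in auto)
  qed
  have ne1: "\<exists>i\<in>I. P i \<noteq> {}"
    using ne[OF xy(2) N] eq1 by blast
  have ne2: "\<exists>i\<in>I. P i \<noteq> Z"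
    using ne[OF xy(1) N'] eq2 by blast
  have cardI: "2 \<le> card I"
  proof -
    have "1 * 4 \<le> k * card V"
      using k n4 by (intro mult_le_mono) auto
    then show ?thesis using V(3) by simp
  qed
  have cZ: "card Z = (if x \<in> N then card V - k else card V - k - 1)"
  proof -
    have "Z = V - insert x (insert y N)"
      by (auto simp: Z_def)
    moreover have "card (insert x (insert y N)) = (if x \<in> N then k else k + 1)"
      using finN yN N(2) k xy by (auto simp: insert_absorb)
    moreover have "insert x (insert y N) \<subseteq> V"
      using N xy by auto
    ultimately show ?thesis
      using finN by (simp add: card_Diff_subset)
  qed
  have cZ2: "2 \<le> card Z" and cZ3: "x \<in> N \<Longrightarrow> 3 \<le> card Z"
    using cZ n4 by auto
  \<comment> \<open>\<open>Z\<close> has fewer than three elements only for \<open>k = 1\<close> and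
    four vertices. A proper nonempty \<open>P i\<close> then makes \<open>E i\<close> a path with 3
    edges, whereas Hong's bound asks for \<open>2 * 3 \<ge> 7\<close>.\<close>
  have big: "3 \<le> card Z \<or> (\<forall>i\<in>I. P i = {} \<or> P i = Z)"
  proof (rule ccontr)
    assume "\<not> ?thesis"
    then obtain i where i: "i \<in> I" "P i \<noteq> {}" "P i \<noteq> Z" and "card Z < 3"
      by auto
    then have k1: "k = 1" "card V = 4" and xN: "x \<notin> N"
      using cZ cZ3 n n4 by (auto split: if_splits)
    then have "N = {}" using N finN by simp
    then have VZ: "V = Z \<union> {x, y}"
      using xy by (auto simp: Z_def)
    obtain p q where pq: "p \<in> Z" "{y, p} \<in> E i" "q \<in> Z" "{y, q} \<notin> E i"
      using i by (auto simp: P_def)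
    have "\<exists>w. {v, w} \<in> E i" if v: "v \<in> V" for v
    proof -
      consider "v = x" | "v = y" | "v \<in> Z"
        using VZ v by blast
      then show ?thesis
      proof cases
        case 1
        then show ?thesis using one[OF i(1) pq(3)] pq by blast
      next
        case 2
        then show ?thesis using pq by blast
      next
        case 3
        then show ?thesis using one[OF i(1) 3] by (metis insert_commute)
      qed
    qed
    then have "2\<^sup>2 + 4 - 1 \<le> 2 * real (card (E i))"
      using heavy_imp_many_edges[OF V(1) E[OF i(1)] _ hv[OF i(1)]] k1 by simp
    moreover have "card (E i) = 3"
    proof -
      have "almost_clique V y N = pairs (V - {y})"
        by (auto simp: almost_clique_def \<open>N = {}\<close> pairs_def)
      then have "card (shift x y (E i)) = 3"
        using S[OF i(1)] V(1) xy k1 by (simp add: card_pairs choose_two)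
      then show ?thesis
        using card_shift[OF xy(3)] by simp
    qed
    ultimately show False by simp
  qed
  have "P i \<subseteq> Z" for i
    by (auto simp: P_def)
  then obtain i j z z' where ij: "i \<in> I" "j \<in> I" "i \<noteq> j" and z: "z \<in> Z" "z' \<in> Z" "z \<noteq> z'" "z \<notin> P i" "z' \<in> P j"
    using choose_two_indices[OF _ cardI cZ2 ne1 ne2 big] by metis
  have xz: "{x, z} \<in> E i"
    using one[OF ij(1) z(1)] z by (auto simp: P_def)
  have yz: "{y, z'} \<in> E j"
    using z by (auto simp: P_def)
  show ?thesis
  proof (cases "x \<in> N")
    case False
    show ?thesis
    proof (rule rainbow_two_stars[OF V k n xy _ N(2) _ _ z(3) ij xz yz])
      show "N \<subseteq> V - {x, y}"
        using False N by auto
      show "{x, v} \<in> E l" "{y, v} \<in> E l" if "l \<in> I" "v \<in> N" for l v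
        using nbr[OF that] that False by auto
    qed (use z off in \<open>auto simp: Z_def\<close>)
  next
    case True
    have "\<not> Z \<subseteq> {z, z'}"
    proof
      assume "Z \<subseteq> {z, z'}"
      then have "card Z \<le> card {z, z'}"
        by (intro card_mono) auto
      then show False
        using cZ3[OF True] z by simp
    qed
    then obtain u where u: "u \<in> Z" "u \<noteq> z" "u \<noteq> z'"
      by blast
    then have uV: "u \<in> V" "u \<noteq> x" "u \<noteq> y" "u \<notin> N"
      by (auto simp: Z_def)
    \<comment> \<open>For \<open>x \<in> N\<close> the vertices \<open>x\<close> and
      \<open>y\<close> are adjacent and share only the \<open>k - 2\<close> neighbours in
      \<open>N - {x}\<close>. Shifting \<open>y\<close> and then \<open>x\<close> towards a spare
      vertex \<open>u\<close> joins \<open>u\<close> to both in every graph, keeps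
      \<open>{x, z}\<close> and \<open>{y, z'}\<close>, and \<open>rainbow_shift\<close> leads
      back.\<close>
    define T where "T i = shift u y (E i)" for i
    define M where "M = insert u (N - {x})"
    have M: "M \<subseteq> V - {x, y}" "card M = k - 1"
      using N uV True finN by (auto simp: M_def card_exchange)
    have offT: "e \<in> T l" if l: "l \<in> I" and e: "e \<in> pairs V" "x \<notin> e" "y \<notin> e" for l e
    proof (cases "u \<in> e")
      case True
      then obtain v where v: "e = {u, v}" "v \<noteq> u" "v \<noteq> y"
        using e by (metis pairsE insert_iff)
      then show ?thesis
        using off[OF l e] uV unfolding T_def by (simp add: shift_target)
    next
      case False
      then show ?thesis
        using off[OF l e] e uV unfolding T_def by (simp add: shift_off)
    qed
    have offTT: "e \<in> shift u x (T l)" if l: "l \<in> I" and e: "e \<in> pairs V" "x \<notin> e" "y \<notin> e" for l e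
    proof (cases "u \<in> e")
      case True
      then obtain v where v: "e = {u, v}" "v \<noteq> u" "v \<noteq> x"
        using e by (metis pairsE insert_iff)
      then show ?thesis
        using offT[OF l e] uV by (simp add: shift_target)
    next
      case False
      then show ?thesis
        using offT[OF l e] e uV by (simp add: shift_off)
    qed
    have keep_x: "{x, v} \<in> shift u x (T l)" if l: "l \<in> I" and v: "v \<in> V" "v \<noteq> u" "v \<noteq> x" "v \<noteq> y" "{x, v} \<in> E l" for l v
    proof -
      have "{x, v} \<in> T l"
        using v uV xy unfolding T_def by (subst shift_off) auto
      moreover have "{u, v} \<in> T l"
        using l v uV by (intro offT) auto
      ultimately show ?thesis
        using v uV by (simp add: shift_source)
    qed
    have keep_y: "{y, v} \<in> shift u x (T l)" if l: "l \<in> I" and v: "v \<in> V" "v \<noteq> u" "v \<noteq> x" "v \<noteq> y" "{y, v} \<in> E l" for l v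
    proof -
      have "{u, v} \<in> E l"
        using l v uV by (intro off) auto
      then have "{y, v} \<in> T l"
        using v uV unfolding T_def by (simp add: shift_source)
      then show ?thesis
        using v uV xy by (subst shift_off) auto
    qed
    have ux: "{x, u} \<in> shift u x (T l)" and uy: "{y, u} \<in> shift u x (T l)" if l: "l \<in> I" for l
    proof -
      have xyl: "{y, x} \<in> E l"
        using xyE[OF l] True by (simp add: insert_commute)
      then have "{u, x} \<in> T l"
        using uV xy unfolding T_def by (simp add: shift_target)
      then have "{u, x} \<in> shift u x (T l)"
        using uV by (simp add: shift_both)
      then show "{x, u} \<in> shift u x (T l)"
        by (simp add: insert_commute)
      have "{u, y} \<in> T l \<or> {x, y} \<in> T l"
      proof (cases "{y, u} \<in> E l")
        case True
        then have "{u, y} \<in> T l"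
          using uV unfolding T_def by (subst shift_both) (auto simp: insert_commute)
        then show ?thesis ..
      next
        case False
        then have "{u, x} \<in> E l"
          using one[OF l u(1)] by (simp add: insert_commute)
        then have "{y, x} \<in> T l"
          using xyl uV xy unfolding T_def by (subst shift_source) auto
        then show ?thesis by (simp add: insert_commute)
      qed
      then have "{u, y} \<in> shift u x (T l)"
        using uV xy by (subst shift_target) auto
      then show "{y, u} \<in> shift u x (T l)"
        by (simp add: insert_commute)
    qed
    have "rainbow k V I (\<lambda>l. shift u x (T l))"
    proof (rule rainbow_two_stars[OF V k n xy M _ _ z(3) ij])
      show "z \<in> V - M - {x, y}" "z' \<in> V - M - {x, y}"
        using z u by (auto simp: M_def Z_def)
      show "{x, z} \<in> shift u x (T i)" "{y, z'} \<in> shift u x (T j)"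
        using keep_x[OF ij(1), of z] keep_y[OF ij(2), of z'] xz yz z u by (auto simp: Z_def)
      fix l v assume "l \<in> I" "v \<in> M"
      then have "v = u \<or> v \<in> N \<and> v \<noteq> x \<and> v \<in> V \<and> v \<noteq> y \<and> v \<noteq> u"
        using N uV by (auto simp: M_def)
      then show "{x, v} \<in> shift u x (T l)" "{y, v} \<in> shift u x (T l)"
        using ux uy keep_x keep_y nbr \<open>l \<in> I\<close> by auto
    qed (use offTT in auto)
    then have "rainbow k V I T"
      using rainbow_shift[OF V(1) uV(1) xy(1) uV(2)] by blast
    then show ?thesis
      using rainbow_shift[OF V(1) uV(1) xy(2) uV(3)] unfolding T_def by blast
  qed
qed

lemma rainbow_step:
  assumes V: "finite V" "finite I" "2 * card I = k * card V" and k: "k \<ge> 1" and n: "card V \<ge> 4 * k - 1"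
    and n4: "4 \<le> card V" "k + 3 \<le> card V" and xy: "x \<in> V" "y \<in> V" "x \<noteq> y"
    and E: "\<And>i. i \<in> I \<Longrightarrow> E i \<subseteq> pairs V" and hv: "\<And>i. i \<in> I \<Longrightarrow> heavy V (real (card V) - 2) (E i)"
    and w: "w \<in> V" "N \<subseteq> V - {w}" "card N = k - 1"
    and S: "\<And>i. i \<in> I \<Longrightarrow> shift x y (E i) = almost_clique V w N"
    and ne: "\<And>w N. w \<in> V \<Longrightarrow> N \<subseteq> V - {w} \<Longrightarrow> card N = k - 1 \<Longrightarrow> \<exists>i\<in>I. E i \<noteq> almost_clique V w N"
  shows "rainbow k V I E"
proof -
  \<comment> \<open>After the shift \<open>x\<close> sees every other neighbour of \<open>y\<close>.
    With \<open>w = x\<close>, some \<open>z \<notin> N\<close> would be joined to \<open>y\<close>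
    but not to \<open>x\<close>.\<close>
  have "w \<noteq> x"
  proof
    assume wx: "w = x"
    have xN: "x \<notin> N" using w wx by auto
    have finN: "finite N" using w V finite_subset by blast
    have "\<not> V \<subseteq> insert x (insert y N)"
    proof
      assume "V \<subseteq> insert x (insert y N)"
      then have "card V \<le> card (insert x (insert y N))"
        using finN by (intro card_mono) auto
      also have "\<dots> \<le> card N + 2"
        using finN by (simp add: card_insert_if)
      finally show False
        using w(3) n4 k by simp
    qed
    then obtain z where z: "z \<in> V" "z \<noteq> x" "z \<noteq> y" "z \<notin> N"
      by blast
    obtain i where i: "i \<in> I"
      using ne[OF w] by blast
    have "{y, z} \<in> shift x y (E i)"
      using S[OF i] wx z xy by (simp add: almost_clique_off)
    then have "{x, z} \<in> shift x y (E i)"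
      using z xy by (simp add: shift_source shift_target)
    then show False
      using S[OF i] wx z almost_clique_star[OF xN, of z V] by simp
  qed
  show ?thesis
  proof (cases "w = y")
    case True
    show ?thesis
      by (rule rainbow_step_at[OF V k n n4 xy E hv _ w(3) _ ne]) (use w S True in auto)
  next
    case False
    show ?thesis
      by (rule rainbow_step_off[OF V k n n4 xy E w \<open>w \<noteq> x\<close> False S ne])
  qed
qed

section \<open>Induction on the sum of labels\<close>

text \<open>The termination measure: a moved edge trades \<open>y\<close> for the smaller
  \<open>x\<close>, while edges that stay contribute the same.\<close>

lemma sum_shift_less:
  fixes E :: "nat set set"
  assumes E: "E \<subseteq> pairs {1..n}" and xy: "x < y"
  shows "(\<Sum>e\<in>shift x y E. \<Sum>e) \<le> (\<Sum>e\<in>E. \<Sum>e)"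
    and "shift x y E \<noteq> E \<Longrightarrow> (\<Sum>e\<in>shift x y E. \<Sum>e) < (\<Sum>e\<in>E. \<Sum>e)"
proof -
  have ne: "x \<noteq> y" using xy by simp
  have fin: "finite E"
    using finite_subset[OF E] by (simp add: finite_pairs)
  have eq: "(\<Sum>e\<in>shift x y E. \<Sum>e) = (\<Sum>e\<in>E. \<Sum>(shift_in x y E e))"
    unfolding shift_eq_image[OF ne] by (simp add: sum.reindex[OF inj_on_shift_in[OF ne]])
  have le: "shift_in x y E e = e \<or> \<Sum>(shift_in x y E e) < \<Sum>e" if "e \<in> E" for e
  proof (cases "y \<in> e \<and> x \<notin> e")
    case True
    moreover have "e \<in> pairs {1..n}"
      using E that by blast
    ultimately obtain z where z: "e = {y, z}" "z \<noteq> y" "z \<noteq> x"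
      by (auto elim: pairsE)
    then show ?thesis
      using xy ne by (auto simp: shift_in_def)
  qed (auto simp: shift_in_def shift_edge_def)
  then have le': "\<Sum>(shift_in x y E e) \<le> \<Sum>e" if "e \<in> E" for e
    using that by (metis less_imp_le order_refl)
  show "(\<Sum>e\<in>shift x y E. \<Sum>e) \<le> (\<Sum>e\<in>E. \<Sum>e)"
    unfolding eq using le' by (rule sum_mono)
  assume "shift x y E \<noteq> E"
  then have "\<exists>e\<in>E. shift_in x y E e \<noteq> e"
    unfolding shift_eq_image[OF ne] by force
  then obtain e where "e \<in> E" "\<Sum>(shift_in x y E e) < \<Sum>e"
    using le by blast
  then show "(\<Sum>e\<in>shift x y E. \<Sum>e) < (\<Sum>e\<in>E. \<Sum>e)"
    unfolding eq using fin le' by (intro sum_strict_mono_ex1) auto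
qed

lemma rainbow_factor_if_heavy:
  fixes n k :: nat and E :: "'i \<Rightarrow> nat set set"
  assumes k: "k \<ge> 1" and n: "n \<ge> 4 * k - 1" and I: "finite I" "2 * card I = k * n"
    and E: "\<And>i. i \<in> I \<Longrightarrow> E i \<subseteq> pairs {1..n}" and hv: "\<And>i. i \<in> I \<Longrightarrow> heavy {1..n} r (E i)"
    and r: "real n - 2 \<le> r"
    and top: "\<And>x. 2 * quad (almost_clique {1..n} n {1..k - 1}) x \<le> r * (\<Sum>v=1..n. (x v)\<^sup>2)"
    and ne: "\<And>w N. w \<in> {1..n} \<Longrightarrow> N \<subseteq> {1..n} - {w} \<Longrightarrow> card N = k - 1 \<Longrightarrow> \<exists>i\<in>I. E i \<noteq> almost_clique {1..n} w N"
  shows "rainbow k {1..n} I E"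
proof -
  have kn: "even (k * n)"
    using I(2) by (metis dvd_triv_left)
  have n4: "4 \<le> n" "k + 3 \<le> n"
  proof -
    show "4 \<le> n"
    proof (cases "k = 1")
      case True
      then have "even n" "3 \<le> n" using n kn by auto
      then show ?thesis by presburger
    qed (use k n in auto)
    then show "k + 3 \<le> n" using n k by (cases "k = 1") auto
  qed
  show ?thesis
    using E hv ne
  proof (induction "\<Sum>i\<in>I. \<Sum>e\<in>E i. \<Sum>e" arbitrary: E rule: less_induct)
    case less
    note Ep = less.prems(1) and hv = less.prems(2) and ne = less.prems(3)
    show ?case
    proof (cases "\<forall>i\<in>I. \<forall>x\<in>{1..n}. \<forall>y\<in>{1..n}. x < y \<longrightarrow> shift x y (E i) = E i")
      case True
      have "\<exists>i\<in>I. E i \<noteq> almost_clique {1..n} n {1..k - 1}"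
        using n4 by (intro ne) auto
      then show ?thesis
        using True n4 r by (intro rainbow_if_all_shifted[OF k n I Ep hv _ top]) auto
    next
      case False
      then obtain i0 x y where *: "i0 \<in> I" "x \<in> {1..n}" "y \<in> {1..n}" "x < y" "shift x y (E i0) \<noteq> E i0"
        by blast
      have xy: "x \<noteq> y" using * by simp
      \<comment> \<open>The pair is shifted in all graphs, including those it leaves unchanged;
        \<open>E i0\<close> alone makes the measure drop strictly.\<close>
      define E' where "E' i = shift x y (E i)" for i
      have Ep': "E' i \<subseteq> pairs {1..n}" if "i \<in> I" for i
        unfolding E'_def using Ep[OF that] *(2) by (rule shift_pairs)
      have hv': "heavy {1..n} r (E' i)" if "i \<in> I" for i
        unfolding E'_def using Ep[OF that] hv[OF that] * xy by (intro heavy_shift) auto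
      show ?thesis
      proof (cases "\<exists>w N. w \<in> {1..n} \<and> N \<subseteq> {1..n} - {w} \<and> card N = k - 1 \<and> (\<forall>i\<in>I. E' i = almost_clique {1..n} w N)")
        case True
        then obtain w N where w: "w \<in> {1..n}" "N \<subseteq> {1..n} - {w}" "card N = k - 1" "\<And>i. i \<in> I \<Longrightarrow> E' i = almost_clique {1..n} w N"
          by blast
        have "heavy {1..n} (real (card {1..n}) - 2) (E i)" if "i \<in> I" for i
          using heavy_mono[OF hv[OF that], of "real n - 2"] r by simp
        then show ?thesis
          using rainbow_step[of "{1..n}" I k x y E w N] k n n4 I * xy Ep w ne unfolding E'_def by simp
      next
        case False
        have "(\<Sum>i\<in>I. \<Sum>e\<in>E' i. \<Sum>e) < (\<Sum>i\<in>I. \<Sum>e\<in>E i. \<Sum>e)"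
          unfolding E'_def using I(1) sum_shift_less[OF Ep *(4)] * by (intro sum_strict_mono_ex1) auto
        then have "rainbow k {1..n} I E'"
        proof (rule less.hyps[OF _ Ep' hv'])
          fix w N assume "w \<in> {1..n}" "N \<subseteq> {1..n} - {w}" "card N = k - 1"
          then show "\<exists>i\<in>I. E' i \<noteq> almost_clique {1..n} w N"
            using False by blast
        qed
        then show ?thesis
          unfolding E'_def using rainbow_shift[OF _ *(2,3) xy] by blast
      qed
    qed
  qed
qed

section \<open>Spectral radii\<close>

lemma simple_graph_iff_pairs: "simple_graph G \<longleftrightarrow> finite (verts G) \<and> edges G \<subseteq> pairs (verts G)"
  by (auto simp: simple_graph_def pairs_def)

text \<open>The maximum of the Rayleigh quotient is an eigenvalue, hence at most the largest one,
  which gives the upper bound; conversely an eigenvector for the largest eigenvalue yields the test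
  vector.\<close>

lemma spectral_radius_rayleigh:
  assumes G: "simple_graph G" "verts G \<noteq> {}"
  shows "2 * quad (edges G) x \<le> \<rho> G * (\<Sum>v\<in>verts G. (x v)\<^sup>2)"
    and "heavy (verts G) (\<rho> G) (edges G)"
proof -
  define V where "V = verts G"
  define E where "E = edges G"
  have V: "finite V" "V \<noteq> {}" and E: "E \<subseteq> pairs V"
    using G by (auto simp: simple_graph_iff_pairs V_def E_def)
  define f where "f = (SOME f. bij_betw f {..<card V} V)"
  have f: "bij_betw f {..<card (verts G)} (verts G)"
    using someI_ex[OF ex_bij_betw_nat_finite[OF V(1)]] by (simp add: f_def V_def lessThan_atLeast0)
  define Sp where "Sp = spectrum (adjacency_matrix f G)"
  have rho: "\<rho> G = Max Sp"
    by (simp add: graph_spectral_radius_def Sp_def f_def V_def)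
  have Sp: "l \<in> Sp \<longleftrightarrow> (\<exists>x. (\<exists>v\<in>V. x v \<noteq> 0) \<and> (\<forall>v\<in>V. (\<Sum>u\<in>V. of_bool ({v, u} \<in> E) * x u) = l * x v))" for l
    unfolding Sp_def spectrum_adjacency_matrix_iff[OF f] V_def E_def by (simp add: of_bool_def)
  have fin: "finite Sp"
    unfolding Sp_def
    by (rule card_finite_spectrum(1)[of _ "card (verts G)"]) (simp add: adjacency_matrix_def)
  obtain u :: "'a \<Rightarrow> real" and M :: real where u: "(\<Sum>i\<in>V. (u i)\<^sup>2) = 1"
    "\<forall>x. (\<Sum>i\<in>V. \<Sum>j\<in>V. of_bool ({i, j} \<in> E) * x i * x j) \<le> M * (\<Sum>i\<in>V. (x i)\<^sup>2)"
    "(\<Sum>i\<in>V. \<Sum>j\<in>V. of_bool ({i, j} \<in> E) * u i * u j) = M * (\<Sum>i\<in>V. (u i)\<^sup>2)"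
    by (rule rayleigh_max[OF V, of "\<lambda>i j. of_bool ({i, j} \<in> E)"])
  have "(\<Sum>j\<in>V. of_bool ({v, j} \<in> E) * u j) = M * u v" if "v \<in> V" for v
    by (rule rayleigh_eigen[OF V(1) _ u(2)[rule_format] u(3) that]) (simp add: insert_commute)
  moreover have "\<exists>v\<in>V. u v \<noteq> 0"
  proof (rule ccontr)
    assume "\<not> ?thesis"
    then have "(\<Sum>i\<in>V. (u i)\<^sup>2) = 0"
      by (intro sum.neutral) auto
    then show False using u(1) by simp
  qed
  ultimately have M: "M \<in> Sp"
    unfolding Sp by blast
  then have "M \<le> \<rho> G"
    unfolding rho using fin by simp
  then have "M * (\<Sum>v\<in>V. (x v)\<^sup>2) \<le> \<rho> G * (\<Sum>v\<in>V. (x v)\<^sup>2)"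
    by (intro mult_right_mono sum_nonneg) auto
  then show "2 * quad (edges G) x \<le> \<rho> G * (\<Sum>v\<in>verts G. (x v)\<^sup>2)"
    using u(2)[rule_format, of x] quad_double_sum[OF V(1) E, of x] unfolding V_def E_def by linarith
  have "\<rho> G \<in> Sp"
    unfolding rho using fin M by (intro Max_in) auto
  then obtain y where y: "\<exists>v\<in>V. y v \<noteq> 0" "\<And>v. v \<in> V \<Longrightarrow> (\<Sum>u\<in>V. of_bool ({v, u} \<in> E) * y u) = \<rho> G * y v"
    unfolding Sp by blast
  have "2 * quad E y = (\<Sum>v\<in>V. y v * (\<Sum>u\<in>V. of_bool ({v, u} \<in> E) * y u))"
    unfolding quad_double_sum[OF V(1) E, symmetric] by (simp add: sum_distrib_left mult_ac)
  also have "\<dots> = (\<Sum>v\<in>V. \<rho> G * (y v)\<^sup>2)"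
    using y(2) by (intro sum.cong) (auto simp: power2_eq_square)
  finally have "\<rho> G * (\<Sum>v\<in>V. \<bar>y v\<bar>\<^sup>2) = 2 * quad E y"
    by (simp add: sum_distrib_left)
  \<comment> \<open>All edges have weight 1, so passing to absolute values keeps the norm and does
    not decrease the form; this makes the test vector nonnegative.\<close>
  also have "\<dots> \<le> 2 * quad E (\<lambda>v. \<bar>y v\<bar>)"
    unfolding quad_def by (simp add: abs_prod[symmetric] sum_mono)
  finally have "\<rho> G * (\<Sum>v\<in>V. \<bar>y v\<bar>\<^sup>2) \<le> 2 * quad E (\<lambda>v. \<bar>y v\<bar>)" .
  then show "heavy (verts G) (\<rho> G) (edges G)"
    using y(1) unfolding heavy_def V_def E_def by (intro exI[of _ "\<lambda>v. \<bar>y v\<bar>"]) auto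
qed

section \<open>Labelled copies of the extremal graph\<close>

lemma edges_join [simp]:
  "{Inl a, Inl b} \<in> edges (graph_join G H) \<longleftrightarrow> {a, b} \<in> edges G"
  "{Inr c, Inr d} \<in> edges (graph_join G H) \<longleftrightarrow> {c, d} \<in> edges H"
  "{Inl a, Inr c} \<in> edges (graph_join G H) \<longleftrightarrow> a \<in> verts G \<and> c \<in> verts H"
  "{Inr c, Inl a} \<in> edges (graph_join G H) \<longleftrightarrow> a \<in> verts G \<and> c \<in> verts H"
proof -
  have l: "{Inl a, Inl b} = Inl ` e \<longleftrightarrow> e = {a, b}" for a b :: 'a and e
    using inj_image_eq_iff[of Inl e "{a, b}"] by auto
  have r: "{Inr c, Inr d} = Inr ` e \<longleftrightarrow> e = {c, d}" for c d :: 'b and e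
    using inj_image_eq_iff[of Inr e "{c, d}"] by auto
  show "{Inl a, Inl b} \<in> edges (graph_join G H) \<longleftrightarrow> {a, b} \<in> edges G"
    "{Inr c, Inr d} \<in> edges (graph_join G H) \<longleftrightarrow> {c, d} \<in> edges H"
    by (auto simp: graph_join_def image_iff l r doubleton_eq_iff)
  show *: "{Inl a, Inr c} \<in> edges (graph_join G H) \<longleftrightarrow> a \<in> verts G \<and> c \<in> verts H"
    by (auto simp: graph_join_def doubleton_eq_iff)
  show "{Inr c, Inl a} \<in> edges (graph_join G H) \<longleftrightarrow> a \<in> verts G \<and> c \<in> verts H"
    using * by (simp add: insert_commute)
qed

lemma edges_union [simp]:
  "{Inl a, Inl b} \<in> edges (graph_union G H) \<longleftrightarrow> {a, b} \<in> edges G"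
  "{Inr c, Inr d} \<in> edges (graph_union G H) \<longleftrightarrow> {c, d} \<in> edges H"
  "{Inl a, Inr c} \<notin> edges (graph_union G H)"
  "{Inr c, Inl a} \<notin> edges (graph_union G H)"
proof -
  have l: "{Inl a, Inl b} = Inl ` e \<longleftrightarrow> e = {a, b}" for a b :: 'a and e
    using inj_image_eq_iff[of Inl e "{a, b}"] by auto
  have r: "{Inr c, Inr d} = Inr ` e \<longleftrightarrow> e = {c, d}" for c d :: 'b and e
    using inj_image_eq_iff[of Inr e "{c, d}"] by auto
  show "{Inl a, Inl b} \<in> edges (graph_union G H) \<longleftrightarrow> {a, b} \<in> edges G"
    "{Inr c, Inr d} \<in> edges (graph_union G H) \<longleftrightarrow> {c, d} \<in> edges H"
    by (auto simp: graph_union_def image_iff l r)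
  show "{Inl a, Inr c} \<notin> edges (graph_union G H)" "{Inr c, Inl a} \<notin> edges (graph_union G H)"
    by (auto simp: graph_union_def)
qed

lemma complete_graph_simps [simp]:
  "verts (complete_graph n) = {1..n}" "edges (complete_graph n) = pairs {1..n}"
  by (simp_all add: complete_graph_def pairs_def)

lemma verts_graph_union: "verts (graph_union G H) = verts G <+> verts H"
  by (simp add: graph_union_def)

lemma verts_H_graph: "verts (H_graph n k) = {1..k - 1} <+> ({1..1} <+> {1..n - k})"
  by (simp add: H_graph_def graph_join_def graph_union_def)

lemma simple_H_graph: "simple_graph (H_graph n k)"
proof -
  have "e \<subseteq> verts (H_graph n k) \<and> card e = 2" if "e \<in> edges (H_graph n k)" for e
    using that unfolding verts_H_graph
    by (auto simp: H_graph_def graph_join_def graph_union_def pairs_def card_image)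
  then show ?thesis
    by (simp add: simple_graph_def verts_H_graph)
qed

text \<open>\<open>w\<close> goes to the single vertex, \<open>N\<close> to the clique joined to
  everything and the rest \<open>R\<close> to the other clique. All \<open>w\<close> and
  \<open>N\<close> are covered because the excluded family may consist of any labelled copy.\<close>

lemma almost_clique_iso_H_graph:
  assumes n: "k \<le> n" "k \<ge> 1" and w: "w \<in> {1..n}" "N \<subseteq> {1..n} - {w}" "card N = k - 1"
  shows "UGraph {1..n} (almost_clique {1..n} w N) \<cong>\<^sub>G H_graph n k"
proof -
  define R where "R = {1..n} - insert w N"
  have fin: "finite N" "finite R"
    using w finite_subset by (auto simp: R_def)
  have "card (insert w N) = k"
    using w fin n by (subst card_insert_disjoint) auto
  then have "card R = n - k"
    unfolding R_def using w fin by (subst card_Diff_subset) auto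
  then obtain q where q: "bij_betw q R {1..n - k}"
    using fin finite_same_card_bij[of R "{1..n - k}"] by auto
  obtain p where p: "bij_betw p N {1..k - 1}"
    using fin w finite_same_card_bij[of N "{1..k - 1}"] by auto
  define f :: "nat \<Rightarrow> nat + nat + nat" where
    "f v = (if v = w then Inr (Inl 1) else if v \<in> N then Inl (p v) else Inr (Inr (q v)))" for v
  have V: "{1..n} = insert w (N \<union> R)"
    using w by (auto simp: R_def)
  have wNR: "w \<notin> N" "w \<notin> R" "N \<inter> R = {}"
    using w by (auto simp: R_def)
  have fw: "f w = Inr (Inl 1)" and fN: "\<And>v. v \<in> N \<Longrightarrow> f v = Inl (p v)" and fR: "\<And>v. v \<in> R \<Longrightarrow> f v = Inr (Inr (q v))"
    using wNR by (auto simp: f_def)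
  have pN: "p ` N = {1..k - 1}" and pi: "inj_on p N" and qR: "q ` R = {1..n - k}" and qi: "inj_on q R"
    using p q by (auto simp: bij_betw_def)
  have "f ` N = Inl ` {1..k - 1}" "f ` R = Inr ` Inr ` {1..n - k}"
    unfolding pN[symmetric] qR[symmetric] by (auto simp: image_image fN fR)
  then have "f ` {1..n} = verts (H_graph n k)"
    unfolding V verts_H_graph Plus_def image_insert image_Un fw by auto
  moreover have inj: "inj_on f {1..n}"
    unfolding V using pi qi wNR by (auto simp: inj_on_def fw fN fR)
  ultimately have bij: "bij_betw f {1..n} (verts (H_graph n k))"
    by (simp add: bij_betw_def)
  have "{u, v} \<in> almost_clique {1..n} w N \<longleftrightarrow> {f u, f v} \<in> edges (H_graph n k)"
    if uv: "u \<in> {1..n}" "v \<in> {1..n}" for u v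
  proof -
    have pv: "p a \<in> {1..k - 1}" "f a = Inl (p a)" "a \<noteq> w" if "a \<in> N" for a
      using that pN fN wNR by auto
    have qv: "q a \<in> {1..n - k}" "f a = Inr (Inr (q a))" "a \<noteq> w" "a \<notin> N" if "a \<in> R" for a
      using that qR fR wNR by auto
    have off: "{a, b} \<in> almost_clique {1..n} w N \<longleftrightarrow> a \<noteq> b" if "a \<in> N \<union> R" "b \<in> N \<union> R" for a b
      using that wNR V by (subst almost_clique_off) auto
    have star: "{w, a} \<in> almost_clique {1..n} w N \<longleftrightarrow> a \<in> N" "{a, w} \<in> almost_clique {1..n} w N \<longleftrightarrow> a \<in> N" for a
      using almost_clique_star[OF wNR(1), of a "{1..n}"] by (simp_all add: insert_commute)
    have pe: "p a = p b \<longleftrightarrow> a = b" if "a \<in> N" "b \<in> N" for a b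
      using pi that by (auto simp: inj_on_def)
    have qe: "q a = q b \<longleftrightarrow> a = b" if "a \<in> R" "b \<in> R" for a b
      using qi that by (auto simp: inj_on_def)
    have H: "{Inl a, Inl b} \<in> edges (H_graph n k) \<longleftrightarrow> a \<in> {1..k - 1} \<and> b \<in> {1..k - 1} \<and> a \<noteq> b"
      "{Inr (Inr a), Inr (Inr b)} \<in> edges (H_graph n k) \<longleftrightarrow> a \<in> {1..n - k} \<and> b \<in> {1..n - k} \<and> a \<noteq> b"
      "{Inl a, Inr c} \<in> edges (H_graph n k) \<longleftrightarrow> a \<in> {1..k - 1} \<and> c \<in> {1..1} <+> {1..n - k}"
      "{Inr c, Inl a} \<in> edges (H_graph n k) \<longleftrightarrow> a \<in> {1..k - 1} \<and> c \<in> {1..1} <+> {1..n - k}"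
      "{Inr (Inl a), Inr (Inr b)} \<notin> edges (H_graph n k)" "{Inr (Inr b), Inr (Inl a)} \<notin> edges (H_graph n k)"
      for a b c
      by (simp_all only: H_graph_def edges_join edges_union verts_graph_union complete_graph_simps pair_in_pairs not_False_eq_True simp_thms)
    show ?thesis
    proof (cases "u = v")
      case True
      have "{f v} \<notin> edges (H_graph n k)"
        using simple_H_graph[of n k] by (auto simp: simple_graph_def)
      moreover have "{v} \<notin> almost_clique {1..n} w N"
        using almost_clique_pairs[OF w(1,2)] by (auto simp: pairs_def)
      ultimately show ?thesis
        using True by simp
    next
      case False
      have "u = w \<or> u \<in> N \<or> u \<in> R" "v = w \<or> v \<in> N \<or> v \<in> R"
        using uv unfolding V by blast+
      then show ?thesis
        by (elim disjE) (use False wNR in \<open>simp_all only: star off fw pv qv H pe qe UnI1 UnI2\<close>, auto dest: pv(1) qv(1,4))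
    qed
  qed
  then show ?thesis
    unfolding graph_iso_def using bij by (intro exI[of _ f]) simp
qed

lemma quad_iso_le:
  assumes V: "finite V" and W: "finite W" and f: "bij_betw f V W" and E: "E \<subseteq> pairs V" and D: "D \<subseteq> pairs W"
    and iso: "\<And>u v. u \<in> V \<Longrightarrow> v \<in> V \<Longrightarrow> {u, v} \<in> E \<longleftrightarrow> {f u, f v} \<in> D"
    and le: "\<And>x. 2 * quad D x \<le> r * (\<Sum>v\<in>W. (x v)\<^sup>2)"
  shows "2 * quad E x \<le> r * (\<Sum>v\<in>V. (x v)\<^sup>2)"
proof -
  define y where "y w = x (the_inv_into V f w)" for w
  have y: "y (f v) = x v" if "v \<in> V" for v
    using f that by (simp add: y_def bij_betw_def the_inv_into_f_f)
  have "2 * quad E x = (\<Sum>u\<in>V. \<Sum>v\<in>V. of_bool ({f u, f v} \<in> D) * y (f u) * y (f v))"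
    unfolding quad_double_sum[OF V E, symmetric] by (intro sum.cong refl) (simp add: y iso)
  also have "\<dots> = (\<Sum>u\<in>W. \<Sum>v\<in>W. of_bool ({u, v} \<in> D) * y u * y v)"
    by (simp only: sum.reindex_bij_betw[OF f, of "\<lambda>v. of_bool ({_, v} \<in> D) * y _ * y v"]
        sum.reindex_bij_betw[OF f, of "\<lambda>u. \<Sum>v\<in>W. of_bool ({u, v} \<in> D) * y u * y v"])
  also have "\<dots> \<le> r * (\<Sum>v\<in>W. (y v)\<^sup>2)"
    using le[of y] by (simp add: quad_double_sum[OF W D])
  also have "(\<Sum>v\<in>W. (y v)\<^sup>2) = (\<Sum>v\<in>V. (x v)\<^sup>2)"
    using sum.reindex_bij_betw[OF f, of "\<lambda>v. (y v)\<^sup>2"] y by simp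
  finally show ?thesis .
qed

text \<open>The test vector is the indicator of \<open>V - {w}\<close>, which spans a complete graph
  and therefore has Rayleigh quotient \<open>card V - 2\<close>.\<close>

lemma almost_clique_rayleigh_ge:
  assumes "w \<in> V" "N \<subseteq> V - {w}" "2 \<le> card V" and V: "finite V"
    and top: "\<And>x. 2 * quad (almost_clique V w N) x \<le> r * (\<Sum>v\<in>V. (x v)\<^sup>2)"
  shows "real (card V) - 2 \<le> r"
proof -
  define x :: "'a \<Rightarrow> real" where "x v = of_bool (v \<noteq> w)" for v
  have c: "card (V - {w}) = card V - 1"
    using assms by simp
  have "(\<Prod>v\<in>e. x v) = 1" if "e \<in> pairs (V - {w})" for e
    using that by (intro prod.neutral) (auto simp: x_def pairs_def)
  then have "real (card (pairs (V - {w}))) = (\<Sum>e\<in>pairs (V - {w}). \<Prod>v\<in>e. x v)"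
    by simp
  also have "\<dots> \<le> quad (almost_clique V w N) x"
    unfolding quad_def
  proof (rule sum_mono2)
    show "finite (almost_clique V w N)"
      using finite_subset[OF almost_clique_pairs[OF assms(1,2)] finite_pairs[OF V]] .
    show "pairs (V - {w}) \<subseteq> almost_clique V w N"
      by (auto simp: almost_clique_def pairs_def)
  qed (simp add: x_def prod_nonneg)
  finally have "2 * real (card (pairs (V - {w}))) \<le> r * (\<Sum>v\<in>V. (x v)\<^sup>2)"
    using top[of x] by linarith
  also have "(\<Sum>v\<in>V. (x v)\<^sup>2) = (\<Sum>v\<in>V - {w}. 1)"
    using assms by (intro sum.mono_neutral_cong_right) (auto simp: x_def)
  finally have "2 * real (card (pairs (V - {w}))) \<le> r * real (card V - 1)"
    by (simp add: c)
  moreover have "2 * card (pairs (V - {w})) = (card V - 1) * (card V - 2)"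
  proof -
    have "even ((card V - 1) * (card V - 1 - 1))"
      by simp
    then have "2 * ((card V - 1) * (card V - 1 - 1) div 2) = (card V - 1) * (card V - 1 - 1)"
      by (rule dvd_mult_div_cancel)
    moreover have "card V - 1 - 1 = card V - 2"
      by simp
    ultimately show ?thesis
      using V by (simp only: card_pairs[OF finite_Diff[OF V]] choose_two c)
  qed
  then have "2 * real (card (pairs (V - {w}))) = real (card V - 1) * real (card V - 2)"
    by (metis of_nat_mult of_nat_numeral)
  ultimately have "real (card V - 1) * real (card V - 2) \<le> real (card V - 1) * r"
    by (simp add: mult.commute)
  then have "real (card V - 2) \<le> r"
    using assms(3) by (simp add: mult_le_cancel_left)
  then show ?thesis
    using assms(3) by simp
qed

theorem theorem1p2:
  fixes k n :: nat and \<G> :: "nat \<Rightarrow> nat ugraph"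
  assumes "k \<ge> 1" and "n \<ge> 4 * k - 1" and "even (k * n)"
    and "\<forall>i \<in> {1..k * n div 2}. simple_graph (\<G> i) \<and> verts (\<G> i) = {1..n}"
    and "\<forall>i \<in> {1..k * n div 2}. \<rho> (\<G> i) \<ge> \<rho> (H_graph n k)"
    and "\<not> ((\<forall>i \<in> {1..k * n div 2}. \<forall>j \<in> {1..k * n div 2}. \<G> i = \<G> j) \<and>
             (\<forall>i \<in> {1..k * n div 2}. \<G> i \<cong>\<^sub>G H_graph n k))"
  shows "admits_rainbow_factor k {1..n} (k * n div 2) \<G>"
proof -
  define I where "I = {1..k * n div 2}"
  define E where "E i = edges (\<G> i)" for i
  define r where "r = \<rho> (H_graph n k)"
  have I: "finite I" "2 * card I = k * n"
    using assms(3) by (auto simp: I_def)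
  have kn: "k \<le> n" "3 \<le> n"
    using assms(1,2) by auto
  have G: "\<G> i = UGraph {1..n} (E i)" "E i \<subseteq> pairs {1..n}" if "i \<in> I" for i
  proof -
    have "simple_graph (\<G> i)" "verts (\<G> i) = {1..n}"
      using assms(4) that by (auto simp: I_def)
    then show "\<G> i = UGraph {1..n} (E i)" "E i \<subseteq> pairs {1..n}"
        using ugraph.collapse[of "\<G> i"] by (simp_all add: E_def simple_graph_iff_pairs)
  qed
  have hv: "heavy {1..n} r (E i)" if "i \<in> I" for i
  proof -
    have "heavy (verts (\<G> i)) (\<rho> (\<G> i)) (E i)"
      unfolding E_def using assms(4) that kn by (intro spectral_radius_rayleigh) (auto simp: I_def)
    moreover have "r \<le> \<rho> (\<G> i)"
      using assms(5) that by (simp add: I_def r_def)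
    ultimately show ?thesis
      using assms(4) that by (auto simp: I_def intro: heavy_mono)
  qed
  have w: "n \<in> {1..n}" "{1..k - 1} \<subseteq> {1..n} - {n}" "card {1..k - 1} = k - 1"
    using kn assms(1) by auto
  obtain f where f: "bij_betw f {1..n} (verts (H_graph n k))"
    "\<And>u v. u \<in> {1..n} \<Longrightarrow> v \<in> {1..n} \<Longrightarrow> {u, v} \<in> almost_clique {1..n} n {1..k - 1} \<longleftrightarrow> {f u, f v} \<in> edges (H_graph n k)"
    using almost_clique_iso_H_graph[OF kn(1) assms(1) w] by (auto simp: graph_iso_def)
  have ne: "verts (H_graph n k) \<noteq> {}"
    by (auto simp: verts_H_graph)
  have H: "finite (verts (H_graph n k))" "edges (H_graph n k) \<subseteq> pairs (verts (H_graph n k))"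
    using simple_H_graph[of n k] by (auto simp: simple_graph_iff_pairs)
  \<comment> \<open>\<open>H_graph\<close> lives on a sum type, so its Rayleigh bound is transported
    to the shifted copy on \<open>{1..n}\<close>.\<close>
  have top: "2 * quad (almost_clique {1..n} n {1..k - 1}) x \<le> r * (\<Sum>v=1..n. (x v)\<^sup>2)" for x
    by (rule quad_iso_le[OF _ H(1) f(1) almost_clique_pairs[OF w(1,2)] H(2) f(2)])
      (auto simp: r_def intro: spectral_radius_rayleigh(1)[OF simple_H_graph ne])
  have r: "real n - 2 \<le> r"
    using almost_clique_rayleigh_ge[OF w(1,2) _ _ top] kn by simp
  have "rainbow k {1..n} I E"
  proof (rule rainbow_factor_if_heavy[OF assms(1,2) I G(2) hv r top])
    \<comment> \<open>If every graph were this one copy, the collection would be constant and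
      isomorphic to \<open>H_graph n k\<close>, the excluded case.\<close>
    fix w N assume wN: "w \<in> {1..n}" "N \<subseteq> {1..n} - {w}" "card N = k - 1"
    show "\<exists>i\<in>I. E i \<noteq> almost_clique {1..n} w N"
    proof (rule ccontr)
      assume "\<not> ?thesis"
      then have "\<G> i = UGraph {1..n} (almost_clique {1..n} w N)" if "i \<in> I" for i
        using G(1)[OF that] that by auto
      then show False
        using assms(6) almost_clique_iso_H_graph[OF kn(1) assms(1) wN] by (simp add: I_def)
    qed
  qed
  then obtain F \<phi> where F: "regular_edges k {1..n} F" "bij_betw \<phi> F I" "\<forall>e\<in>F. e \<in> E (\<phi> e)"
    by (auto simp: rainbow_def)
  have "regular_graph k (UGraph {1..n} F)"
    using F(1) by (auto simp: regular_graph_def simple_graph_iff_pairs regular_edges_def vertex_degree_def)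
  moreover have "admits_rainbow (k * n div 2) \<G> (UGraph {1..n} F)"
    using F(2,3) by (auto simp: admits_rainbow_def I_def E_def)
  ultimately show ?thesis
    unfolding admits_rainbow_factor_def by (intro exI[of _ "UGraph {1..n} F"]) simp
qed

end
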